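(* Let $W:\mathbb{R}^d\to\mathbb{R}$ be bounded and continuous, and obey $W(x+a)=W(x)$ for all $x\in\mathbb{R}^d$ and $a\in\mathbb{Z}^d$. Let $\alpha=(\alpha_1,\dots,\alpha_d)\in\mathbb{R}^d$ be such that $\{(\alpha_1n,\alpha_2n,\dots,\alpha_dn)\mid n\in\mathbb{Z}\}$ is dense in $\mathbb{R}^d/\mathbb{Z}^d$ (i.e., $1,\alpha_1,\dots,\alpha_d$ are rationally independent). Let $f:\mathbb{Z}\to\mathbb{R}^d$ obey $$\lim_{|n|\to\infty}\ \sup_{|m|\le L}|f(n)-f(n+m)|=0$$ for each $L$. Let $V_0(n)=W(\alpha n)$ and let $V(n)=W(\alpha n+f(n))$ for $n\in\mathbb{Z}$. On $\ell^2(\mathbb{Z})$, let $(h_0u)(n)=u(n+1)+u(n-1)$. Then $$\sigma_{\mathrm{ess}}(h_0+V)=\sigma(h_0+V_0).$$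
   Context: $V$ and $V_0$ act on $\ell^2(\mathbb{Z})$ as multiplication operators. $\sigma,\sigma_{\mathrm{ess}}$ denote spectrum and essential spectrum. *)

theory Defs
  imports "HOL-Analysis.Analysis"
begin

text \<open>The Hilbert space of square-summable functions on the integers is represented by its carrier
  in the type of all functions. Operators are maps on the whole function type, of which only the
  values on the carrier matter.\<close>

definition ell2 :: "(int \<Rightarrow> complex) set" where
  "ell2 = {u. (\<lambda>n. (cmod (u n))\<^sup>2) summable_on UNIV}"

definition ell2_norm :: "(int \<Rightarrow> complex) \<Rightarrow> real" where
  "ell2_norm u = sqrt (\<Sum>\<^sub>\<infinity>n. (cmod (u n))\<^sup>2)"

type_synonym seq_op = "(int \<Rightarrow> complex) \<Rightarrow> (int \<Rightarrow> complex)"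

definition ell2_bounded_op :: "seq_op \<Rightarrow> bool" where
  "ell2_bounded_op T \<longleftrightarrow>
     (\<forall>u\<in>ell2. T u \<in> ell2) \<and>
     (\<forall>u\<in>ell2. \<forall>v\<in>ell2. T (\<lambda>n. u n + v n) = (\<lambda>n. T u n + T v n)) \<and>
     (\<forall>c. \<forall>u\<in>ell2. T (\<lambda>n. c * u n) = (\<lambda>n. c * T u n)) \<and>
     (\<exists>C. \<forall>u\<in>ell2. ell2_norm (T u) \<le> C * ell2_norm u)"

definition op_shift :: "seq_op \<Rightarrow> complex \<Rightarrow> seq_op" where
  "op_shift T z u = (\<lambda>n. T u n - z * u n)"

text \<open>The spectrum of a bounded operator: the points at which the shifted operator has no bounded
  two-sided inverse.\<close>

definition ell2_spectrum :: "seq_op \<Rightarrow> complex set" where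
  "ell2_spectrum T =
     {z. \<not> (\<exists>R. ell2_bounded_op R \<and>
              (\<forall>u\<in>ell2. R (op_shift T z u) = u \<and> op_shift T z (R u) = u))}"

definition ell2_eigenspace :: "seq_op \<Rightarrow> complex \<Rightarrow> (int \<Rightarrow> complex) set" where
  "ell2_eigenspace T z = {u \<in> ell2. T u = (\<lambda>n. z * u n)}"

text \<open>Containment in the complex linear span of finitely many functions.\<close>

definition finite_dimensional :: "(int \<Rightarrow> complex) set \<Rightarrow> bool" where
  "finite_dimensional S \<longleftrightarrow>
     (\<exists>B. finite B \<and> (\<forall>u\<in>S. \<exists>c. u = (\<lambda>n. \<Sum>b\<in>B. c b * b n)))"

text \<open>For self-adjoint operators, the only ones considered here, the discrete spectrum consists of
  the isolated points of the spectrum that are eigenvalues of finite multiplicity, and the geometric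
  multiplicity is the rank of the spectral projection. The essential spectrum is the rest of the
  spectrum.\<close>

definition ell2_discrete_spectrum :: "seq_op \<Rightarrow> complex set" where
  "ell2_discrete_spectrum T =
     {z. z isolated_in ell2_spectrum T \<and>
         (\<exists>u \<in> ell2_eigenspace T z. u \<noteq> (\<lambda>n. 0)) \<and>
         finite_dimensional (ell2_eigenspace T z)}"

definition ell2_essential_spectrum :: "seq_op \<Rightarrow> complex set" where
  "ell2_essential_spectrum T = ell2_spectrum T - ell2_discrete_spectrum T"

definition h0 :: seq_op where
  "h0 u = (\<lambda>n. u (n + 1) + u (n - 1))"

definition mult_op :: "(int \<Rightarrow> real) \<Rightarrow> seq_op" where
  "mult_op V u = (\<lambda>n. complex_of_real (V n) * u n)"

definition op_add :: "seq_op \<Rightarrow> seq_op \<Rightarrow> seq_op" where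
  "op_add S T u = (\<lambda>n. S u n + T u n)"

definition integer_lattice :: "(real^'d) set" where
  "integer_lattice = {a. \<forall>i. a $ i \<in> \<int>}"

text \<open>The torus is the set of cosets of the integer lattice with the quotient topology.\<close>

definition torus_class :: "real^'d \<Rightarrow> (real^'d) set" where
  "torus_class x = {x + a |a. a \<in> integer_lattice}"

definition torus_topology :: "(real^'d) set topology" where
  "torus_topology = topology (\<lambda>U. U \<subseteq> range torus_class \<and> open (torus_class -` U))"

lemma openin_torus_topology:
  "openin torus_topology U \<longleftrightarrow> U \<subseteq> range torus_class \<and> open (torus_class -` U)"
proof -
  have "istopology (\<lambda>U. U \<subseteq> range torus_class \<and> open (torus_class -` U))"
    unfolding istopology_def by (auto simp: vimage_Union)
  then show ?thesis
    unfolding torus_topology_def by (subst topology_inverse') auto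
qed

lemma topspace_torus_topology: "topspace torus_topology = range torus_class"
  unfolding topspace_def openin_torus_topology
  by (rule antisym) (blast, rule Union_upper, simp add: vimage_def)

lemma quotient_map_torus_class: "quotient_map euclidean torus_topology torus_class"
  unfolding quotient_map_def
  by (simp add: topspace_torus_topology openin_torus_topology vimage_def)

end

theory Submission
  imports Defs "HOL-Complex_Analysis.Great_Picard"
begin

text \<open>By density and slow variation, every window of \<open>V\<close> far away from the origin is close to a window of
  \<open>V\<^sub>0\<close>, and every window of \<open>V\<^sub>0\<close> recurs in \<open>V\<close> arbitrarily far away.

  If \<open>z\<close> is in the spectrum of \<open>h\<^sub>0 + V\<^sub>0\<close>, recurrence yields approximate eigenvectors of \<open>h\<^sub>0 + V\<close> with
  disjoint supports. So \<open>z\<close> is in the spectrum of \<open>h\<^sub>0 + V\<close>. It is not isolated there: near each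
  approximate eigenvector there would be an eigenvector, but eigenspaces are at most one-dimensional
  by constancy of the Wronskian.

  If \<open>z\<close> is not in the spectrum of \<open>h\<^sub>0 + V\<^sub>0\<close>, the lower bound for \<open>h\<^sub>0 + V\<^sub>0 - z\<close> transfers to windows
  of \<open>h\<^sub>0 + V - z\<close> far away from the origin. Summing over the windows bounds \<open>\<parallel>x\<parallel>\<close> by
  \<open>\<parallel>(h\<^sub>0 + V - z) x\<parallel>\<close> and finitely many coordinates of \<open>x\<close>. Hence bounded sequences of approximate
  eigenvectors have convergent subsequences. This makes \<open>z\<close> an eigenvalue if it is in the spectrum of
  \<open>h\<^sub>0 + V\<close>, and isolated because eigenvectors of different eigenvalues are orthogonal.\<close>

section \<open>Symmetric operators on real Hilbert spaces\<close>

text \<open>Lax-Milgram by the Banach fixed point theorem: a solution is a fixed point of the damped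
  iteration \<open>F\<close>, which leaves \<open>R\<close> invariant. The version on a subspace
  serves the closure of the range in \<open>symmetric_gap_near_kernel\<close>.\<close>

lemma coercive_surj_on:
  fixes A :: "'a::{real_inner, complete_space} \<Rightarrow> 'a"
  assumes R: "subspace R" "closed R" and A: "bounded_linear A" "\<And>x. x \<in> R \<Longrightarrow> A x \<in> R"
    and c: "c > 0" "\<And>x. x \<in> R \<Longrightarrow> c * (norm x)\<^sup>2 \<le> x \<bullet> A x"
    and y: "y \<in> R"
  shows "\<exists>x\<in>R. A x = y"
proof -
  interpret A: bounded_linear A by (rule A)
  obtain M0 where M0: "\<And>x. norm (A x) \<le> norm x * M0" using A.bounded by blast
  \<comment> \<open>The maximum with \<open>c\<close> makes \<open>M\<close> positive and keeps
    \<open>1 - (c / M)\<^sup>2\<close> nonnegative under the square root in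
    \<open>q\<close>.\<close>
  define M where "M = max M0 c"
  have M: "norm (A x) \<le> M * norm x" for x
    using M0[of x] mult_right_mono[of M0 M "norm x"] by (simp add: M_def mult.commute)
  have "M > 0" "c \<le> M" using c by (auto simp: M_def)
  \<comment> \<open>This \<open>t\<close> minimizes
    \<open>1 - 2 * t * c + t\<^sup>2 * M\<^sup>2\<close>; the minimum is
    \<open>q\<^sup>2\<close>.\<close>
  define t where "t = c / M\<^sup>2"
  define q where "q = sqrt (1 - (c / M)\<^sup>2)"
  define F where "F x = x - t *\<^sub>R (A x - y)" for x
  have q: "0 \<le> q" "q < 1"
    using \<open>M > 0\<close> \<open>c \<le> M\<close> c(1) by (auto simp: q_def power_le_one)
  have t: "t > 0" using \<open>M > 0\<close> c by (simp add: t_def)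
  have step: "norm (d - t *\<^sub>R A d) \<le> q * norm d" if "d \<in> R" for d
  proof -
    have "(norm (d - t *\<^sub>R A d))\<^sup>2 = (norm d)\<^sup>2 - 2 * t * (d \<bullet> A d) + t\<^sup>2 * (norm (A d))\<^sup>2"
      unfolding power2_norm_eq_inner
      by (simp add: inner_diff_left inner_diff_right inner_commute[of "A d" d] power2_eq_square algebra_simps)
    also have "\<dots> \<le> (norm d)\<^sup>2 - 2 * t * (c * (norm d)\<^sup>2) + t\<^sup>2 * (M * norm d)\<^sup>2"
      using c(2)[OF that] t by (intro add_mono diff_mono mult_left_mono power_mono M) auto
    also have "\<dots> = (1 - (c / M)\<^sup>2) * (norm d)\<^sup>2"
      using \<open>M > 0\<close> by (simp add: t_def field_simps power2_eq_square)
    also have "\<dots> = (q * norm d)\<^sup>2"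
      using \<open>M > 0\<close> \<open>c \<le> M\<close> c(1) by (simp add: q_def power_mult_distrib power_le_one)
    finally show ?thesis
      using q by (meson mult_nonneg_nonneg norm_ge_zero power2_le_imp_le)
  qed
  have "\<exists>!x\<in>R. F x = x"
  proof (rule Banach_fix[OF _ _ q])
    show "complete R" using R(2) by (simp add: complete_eq_closed)
    show "R \<noteq> {}" using y by blast
    show "F ` R \<subseteq> R"
      using R(1) A(2) y by (auto simp: F_def intro!: subspace_diff subspace_mul)
    fix x z assume xz: "x \<in> R" "z \<in> R"
    have "F x - F z = (x - z) - t *\<^sub>R A (x - z)"
      by (simp add: F_def A.diff algebra_simps)
    then show "dist (F x) (F z) \<le> q * dist x z"
      using step[of "x - z"] xz R(1) by (simp add: dist_norm subspace_diff)
  qed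
  then obtain x where "x \<in> R" "F x = x" by blast
  then show ?thesis using t by (intro bexI[of _ x]) (auto simp: F_def)
qed

text \<open>Evaluating the nonnegative form at \<open>x - t *\<^sub>R B x\<close> with
  \<open>t = 1 / K\<close> gives this variant of Cauchy-Schwarz. It converts a lower bound for
  \<open>norm (B x)\<close> into one for \<open>x \<bullet> B x\<close>.\<close>

lemma nonneg_symmetric_norm_le:
  fixes B :: "'a::real_inner \<Rightarrow> 'a"
  assumes "linear B" and sym: "\<And>x y. B x \<bullet> y = x \<bullet> B y"
    and pos: "\<And>x. 0 \<le> x \<bullet> B x" and K: "K > 0" "\<And>x. norm (B x) \<le> K * norm x"
  shows "(norm (B x))\<^sup>2 \<le> K * (x \<bullet> B x)"
proof -
  interpret B: linear B by fact
  define t where "t = 1 / K"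
  have t: "t > 0" "t * K = 1" using K(1) by (auto simp: t_def)
  have "B x \<bullet> B (B x) \<le> norm (B x) * norm (B (B x))" by (rule norm_cauchy_schwarz)
  also have "\<dots> \<le> K * (norm (B x))\<^sup>2"
    using mult_left_mono[OF K(2)[of "B x"], of "norm (B x)"] by (simp add: power2_eq_square algebra_simps)
  finally have 1: "B x \<bullet> B (B x) \<le> K * (norm (B x))\<^sup>2" .
  have "0 \<le> (x - t *\<^sub>R B x) \<bullet> B (x - t *\<^sub>R B x)" by (rule pos)
  also have "\<dots> = x \<bullet> B x - 2 * t * (norm (B x))\<^sup>2 + t\<^sup>2 * (B x \<bullet> B (B x))"
    unfolding power2_norm_eq_inner
    by (simp add: B.diff B.scaleR inner_diff_left inner_diff_right sym[symmetric] inner_commute[of _ "B x"]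
        power2_eq_square algebra_simps)
  also have "\<dots> \<le> x \<bullet> B x - 2 * t * (norm (B x))\<^sup>2 + t\<^sup>2 * (K * (norm (B x))\<^sup>2)"
    using 1 by (intro add_left_mono mult_left_mono) auto
  also have "\<dots> = x \<bullet> B x - t * (norm (B x))\<^sup>2"
    using t(2) by (simp add: power2_eq_square algebra_simps)
  finally have "t * (norm (B x))\<^sup>2 \<le> x \<bullet> B x" by simp
  then have "K * (t * (norm (B x))\<^sup>2) \<le> K * (x \<bullet> B x)" using K(1) by (simp only: mult_le_cancel_left_pos)
  moreover have "K * (t * (norm (B x))\<^sup>2) = (norm (B x))\<^sup>2" using t(2) by (simp add: mult.assoc[symmetric] mult.commute)
  ultimately show ?thesis by simp
qed

text \<open>With \<open>s\<close> the infimum of \<open>norm (N x) / norm x\<close>, the operator \<open>N\<^sup>2 - s\<^sup>2\<close> is nonnegative and not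
  bounded below, so one of its factors \<open>N - s\<close>, \<open>N + s\<close> is not bounded below either.\<close>

lemma symmetric_norm_ge_of_gap:
  fixes N :: "'a::real_inner \<Rightarrow> 'a"
  assumes N: "bounded_linear N" and sym: "\<And>x y. N x \<bullet> y = x \<bullet> N y"
    and gap: "\<And>s. \<bar>s\<bar> < r \<Longrightarrow> \<exists>c>0. \<forall>x. c * norm x \<le> norm (N x - s *\<^sub>R x)"
  shows "r * norm x \<le> norm (N x)"
proof (rule ccontr)
  interpret N: bounded_linear N by (rule N)
  assume neg: "\<not> r * norm x \<le> norm (N x)"
  define T where "T = {norm (N y) | y. norm y = 1}"
  define s where "s = Inf T"
  have bdd: "bdd_below T" by (rule bdd_belowI[of _ 0]) (auto simp: T_def)
  have "x \<noteq> 0" using neg by (auto simp: N.zero)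
  then have xT: "norm (N x) / norm x \<in> T"
    by (auto simp: T_def N.scaleR divide_inverse_commute intro!: exI[of _ "x /\<^sub>R norm x"])
  have "s \<le> norm (N x) / norm x" unfolding s_def by (rule cInf_lower[OF xT bdd])
  also have "\<dots> < r" using neg \<open>x \<noteq> 0\<close> by (simp add: field_simps)
  finally have "s < r" .
  have "0 \<le> s" unfolding s_def using xT by (intro cInf_greatest) (auto simp: T_def)
  have lower: "s * norm y \<le> norm (N y)" for y
  proof (cases "y = 0")
    case False
    then have "norm (N y) / norm y \<in> T"
      by (auto simp: T_def N.scaleR divide_inverse_commute intro!: exI[of _ "y /\<^sub>R norm y"])
    then have "s \<le> norm (N y) / norm y" unfolding s_def by (rule cInf_lower[OF _ bdd])
    then show ?thesis using False by (simp add: field_simps)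
  qed (simp add: N.zero)
  obtain c1 where c1: "c1 > 0" "\<And>x. c1 * norm x \<le> norm (N x - s *\<^sub>R x)"
    using gap[of s] \<open>0 \<le> s\<close> \<open>s < r\<close> by auto
  obtain c2 where c2: "c2 > 0" "\<And>x. c2 * norm x \<le> norm (N x - (-s) *\<^sub>R x)"
    using gap[of "-s"] \<open>0 \<le> s\<close> \<open>s < r\<close> by auto
  define B where "B y = N (N y) - s\<^sup>2 *\<^sub>R y" for y
  have B: "bounded_linear B" unfolding B_def
    by (intro bounded_linear_sub bounded_linear_compose[OF N N, unfolded o_def] bounded_linear_scaleR_right)
  then interpret B: bounded_linear B .
  obtain K where K: "K > 0" "\<And>x. norm (B x) \<le> norm x * K" using B.pos_bounded by blast
  have inner_B: "y \<bullet> B y = (norm (N y))\<^sup>2 - s\<^sup>2 * (norm y)\<^sup>2" for y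
    by (simp add: B_def inner_diff_right sym[symmetric] power2_norm_eq_inner)
  \<comment> \<open>\<open>B\<close> is the product of \<open>N - s\<close> and
    \<open>N + s\<close>, so the two lower bounds multiply.\<close>
  have B_ge: "c1 * c2 * norm y \<le> norm (B y)" for y
  proof -
    have "B y = (N (N y - (-s) *\<^sub>R y)) - s *\<^sub>R (N y - (-s) *\<^sub>R y)"
      by (simp add: B_def N.diff N.add N.scaleR power2_eq_square algebra_simps)
    then have "c1 * norm (N y - (-s) *\<^sub>R y) \<le> norm (B y)" using c1(2) by metis
    moreover have "c1 * (c2 * norm y) \<le> c1 * norm (N y - (-s) *\<^sub>R y)"
      using c1(1) c2(2)[of y] by (simp only: mult_le_cancel_left_pos)
    ultimately show ?thesis by (simp add: mult.assoc)
  qed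
  define \<kappa> where "\<kappa> = (c1 * c2)\<^sup>2 / K"
  have \<kappa>: "\<kappa> > 0" using c1 c2 K by (simp add: \<kappa>_def)
  \<comment> \<open>On the unit sphere the form of \<open>B\<close> is at least
    \<open>\<kappa>\<close>, which pushes the infimum of \<open>norm (N y)\<close> strictly above
    \<open>s\<close>.\<close>
  have better: "(s\<^sup>2 + \<kappa>) \<le> (norm (N y))\<^sup>2" if "norm y = 1" for y
  proof -
    have "(c1 * c2 * norm y)\<^sup>2 \<le> (norm (B y))\<^sup>2"
      using B_ge[of y] c1 c2 by (intro power_mono) auto
    also have "\<dots> \<le> K * (y \<bullet> B y)"
    proof (rule nonneg_symmetric_norm_le)
      show "linear B" by (rule B.linear)
      show "B x \<bullet> y = x \<bullet> B y" for x y by (simp add: B_def inner_diff_left inner_diff_right sym)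
      show "0 \<le> x \<bullet> B x" for x
        using power_mono[OF lower[of x], of 2] \<open>0 \<le> s\<close> by (simp add: inner_B power_mult_distrib)
    qed (use K in \<open>auto simp: mult.commute\<close>)
    finally show ?thesis using that K by (simp add: inner_B \<kappa>_def field_simps)
  qed
  have "sqrt (s\<^sup>2 + \<kappa>) \<le> s" unfolding s_def
  proof (rule cInf_greatest)
    fix z assume "z \<in> T"
    then obtain y where "norm y = 1" "z = norm (N y)" by (auto simp: T_def)
    then show "sqrt ((Inf T)\<^sup>2 + \<kappa>) \<le> z"
      using better[of y] by (simp add: real_sqrt_le_iff s_def real_le_lsqrt)
  qed (use xT in auto)
  then have "s\<^sup>2 + \<kappa> \<le> s\<^sup>2" using \<open>0 \<le> s\<close> by (meson sqrt_le_D)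
  then show False using \<kappa> by simp
qed

text \<open>In spectral terms, the square of \<open>S\<close> has no spectrum strictly between 0 and
  \<open>\<delta>\<^sup>2\<close>. Subtracting the midpoint \<open>r\<close> of this interval gives
  \<open>N\<close> with \<open>r * norm x \<le> norm (N x)\<close>, and squaring this inequality
  yields the claim.\<close>

lemma symmetric_gap_at_zero:
  fixes S :: "'a::real_inner \<Rightarrow> 'a"
  assumes S: "bounded_linear S" and sym: "\<And>x y. S x \<bullet> y = x \<bullet> S y" and "\<delta> > 0"
    and gap: "\<And>\<mu>. \<mu> \<noteq> 0 \<Longrightarrow> \<bar>\<mu>\<bar> < \<delta> \<Longrightarrow> \<exists>c>0. \<forall>x. c * norm x \<le> norm (S x - \<mu> *\<^sub>R x)"
  shows "\<delta> * norm (S x) \<le> norm (S (S x))"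
proof -
  interpret S: bounded_linear S by (rule S)
  define r where "r = \<delta>\<^sup>2 / 2"
  define N where "N y = S (S y) - r *\<^sub>R y" for y
  have "r > 0" using \<open>\<delta> > 0\<close> by (simp add: r_def)
  have "r * norm x \<le> norm (N x)"
  proof (rule symmetric_norm_ge_of_gap)
    show "bounded_linear N" unfolding N_def
      by (intro bounded_linear_sub bounded_linear_compose[OF S S, unfolded o_def] bounded_linear_scaleR_right)
    show "N x \<bullet> y = x \<bullet> N y" for x y by (simp add: N_def inner_diff_left inner_diff_right sym)
    fix s :: real assume s: "\<bar>s\<bar> < r"
    \<comment> \<open>\<open>N - s\<close> factors into \<open>S - m\<close> and
      \<open>S + m\<close>, and \<open>m\<close> lies strictly between 0 and
      \<open>\<delta>\<close>, so \<open>gap\<close> covers both factors.\<close>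
    define m where "m = sqrt (r + s)"
    have m2: "m * m = r + s" using s by (simp add: m_def)
    have "m > 0" using s by (simp add: m_def)
    have "r + s < \<delta>\<^sup>2" using s by (simp add: r_def)
    then have "m < \<delta>" using \<open>\<delta> > 0\<close> by (simp add: m_def real_less_lsqrt)
    obtain c1 where c1: "c1 > 0" "\<And>x. c1 * norm x \<le> norm (S x - m *\<^sub>R x)"
      using gap[of m] \<open>m > 0\<close> \<open>m < \<delta>\<close> by auto
    obtain c2 where c2: "c2 > 0" "\<And>x. c2 * norm x \<le> norm (S x - (-m) *\<^sub>R x)"
      using gap[of "-m"] \<open>m > 0\<close> \<open>m < \<delta>\<close> by auto
    show "\<exists>c>0. \<forall>x. c * norm x \<le> norm (N x - s *\<^sub>R x)"
    proof (intro exI[of _ "c1 * c2"] conjI allI)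
      fix y
      have "N y - s *\<^sub>R y = (S (S y - (-m) *\<^sub>R y)) - m *\<^sub>R (S y - (-m) *\<^sub>R y)"
        by (simp add: N_def S.add S.scaleR algebra_simps m2)
      then have "c1 * norm (S y - (-m) *\<^sub>R y) \<le> norm (N y - s *\<^sub>R y)" using c1(2) by metis
      moreover have "c1 * (c2 * norm y) \<le> c1 * norm (S y - (-m) *\<^sub>R y)"
        using c1(1) c2(2)[of y] by (simp only: mult_le_cancel_left_pos)
      ultimately show "c1 * c2 * norm y \<le> norm (N y - s *\<^sub>R y)" by (simp add: mult.assoc)
    qed (use c1 c2 in auto)
  qed
  then have "(r * norm x)\<^sup>2 \<le> (norm (N x))\<^sup>2" using \<open>r > 0\<close> by (intro power_mono) auto
  \<comment> \<open>The term \<open>(r * norm x)\<^sup>2\<close> cancels, and \<open>2 * r\<close>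
    is \<open>\<delta>\<^sup>2\<close>.\<close>
  also have "\<dots> = (norm (S (S x)))\<^sup>2 - 2 * r * (norm (S x))\<^sup>2 + (r * norm x)\<^sup>2"
    unfolding power_mult_distrib power2_norm_eq_inner
    by (simp add: N_def inner_diff_left inner_diff_right sym[of "S x" x]
        inner_commute[of x "S (S x)"] power2_eq_square
        algebra_simps)
  finally have "(\<delta> * norm (S x))\<^sup>2 \<le> (norm (S (S x)))\<^sup>2" by (simp add: r_def power_mult_distrib)
  then show ?thesis by (rule power2_le_imp_le) simp
qed

text \<open>By continuity, \<open>S\<close> is bounded below by \<open>\<delta>\<close> on the
  closure \<open>R\<close> of its range. Removing from \<open>x\<close> its component
  \<open>v\<close> in \<open>R\<close> leaves a kernel vector, and \<open>norm v\<close> is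
  controlled by \<open>norm (S v) = norm (S x)\<close>.\<close>

lemma symmetric_gap_near_kernel:
  fixes S :: "'a::{real_inner, complete_space} \<Rightarrow> 'a"
  assumes S: "bounded_linear S" and sym: "\<And>x y. S x \<bullet> y = x \<bullet> S y" and "\<delta> > 0"
    and gap: "\<And>x. \<delta> * norm (S x) \<le> norm (S (S x))"
  shows "\<exists>y. S y = 0 \<and> \<delta> * norm (x - y) \<le> norm (S x)"
proof -
  interpret S: bounded_linear S by (rule S)
  define R where "R = closure (range S)"
  have R_iff: "x \<in> R \<longleftrightarrow> (\<exists>g. (\<lambda>n. S (g n)) \<longlonglongrightarrow> x)" for x
  proof
    assume "x \<in> R"
    then obtain f where f: "\<forall>n. f n \<in> range S" "f \<longlonglongrightarrow> x"
      unfolding R_def closure_sequential by (elim exE conjE)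
    then have "\<forall>n. \<exists>y. f n = S y" by (simp add: image_iff)
    then obtain g where "\<forall>n. f n = S (g n)" by (rule choice[THEN exE])
    then have "f = (\<lambda>n. S (g n))" by (simp add: fun_eq_iff)
    with f(2) show "\<exists>g. (\<lambda>n. S (g n)) \<longlonglongrightarrow> x" by (intro exI[of _ g]) simp
  next
    assume "\<exists>g. (\<lambda>n. S (g n)) \<longlonglongrightarrow> x"
    then obtain g where "(\<lambda>n. S (g n)) \<longlonglongrightarrow> x" by (elim exE)
    then show "x \<in> R"
      unfolding R_def closure_sequential by (intro exI[of _ "\<lambda>n. S (g n)"] conjI allI rangeI)
  qed
  have range_R: "S x \<in> R" for x
    unfolding R_iff by (rule exI[of _ "\<lambda>n. x"]) simp
  have sub: "subspace R"
    unfolding subspace_def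
  proof (intro conjI ballI allI)
    show "0 \<in> R" using range_R[of 0] by (simp add: S.zero)
  next
    fix x y assume "x \<in> R" "y \<in> R"
    then obtain f g where "(\<lambda>n. S (f n)) \<longlonglongrightarrow> x" "(\<lambda>n. S (g n)) \<longlonglongrightarrow> y"
      unfolding R_iff by (elim exE)
    from tendsto_add[OF this] show "x + y \<in> R"
      unfolding R_iff S.add[symmetric] by (rule exI[of _ "\<lambda>n. f n + g n"])
  next
    fix c x assume "x \<in> R"
    then obtain f where "(\<lambda>n. S (f n)) \<longlonglongrightarrow> x"
      unfolding R_iff by (elim exE)
    from tendsto_scaleR[OF tendsto_const this] show "c *\<^sub>R x \<in> R"
      unfolding R_iff S.scaleR[symmetric] by (rule exI[of _ "\<lambda>n. c *\<^sub>R f n"])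
  qed
  have gap_R: "\<delta> * norm v \<le> norm (S v)" if v: "v \<in> R" for v
  proof -
    obtain f where f: "(\<lambda>n. S (f n)) \<longlonglongrightarrow> v"
      using v unfolding R_iff by (elim exE)
    have "(\<lambda>n. norm (S (S (f n))) - \<delta> * norm (S (f n))) \<longlonglongrightarrow> norm (S v) - \<delta> * norm v"
      by (intro tendsto_intros S.tendsto f)
    then have "0 \<le> norm (S v) - \<delta> * norm v"
      by (rule LIMSEQ_le_const) (simp add: gap)
    then show ?thesis by simp
  qed
  \<comment> \<open>The square of \<open>S\<close> is coercive on \<open>R\<close> while
    \<open>S\<close> itself need not be, so \<open>v\<close> is found from the squared equation;
    symmetry then yields \<open>S v = S x\<close>.\<close>
  have "\<exists>v\<in>R. S (S v) = S (S x)"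
  proof (rule coercive_surj_on[OF sub])
    show "closed R" by (simp add: R_def)
    show "bounded_linear (\<lambda>v. S (S v))" by (rule bounded_linear_compose[OF S S])
    show "\<delta>\<^sup>2 > 0" using \<open>\<delta> > 0\<close> by simp
    show "\<delta>\<^sup>2 * (norm v)\<^sup>2 \<le> v \<bullet> S (S v)" if v: "v \<in> R" for v
    proof -
      have "(\<delta> * norm v)\<^sup>2 \<le> (norm (S v))\<^sup>2"
        using gap_R[OF v] \<open>\<delta> > 0\<close> by (intro power_mono) auto
      then show ?thesis by (simp only: power_mult_distrib power2_norm_eq_inner sym)
    qed
  qed (rule range_R)+
  then obtain v where v: "v \<in> R" "S (S v) = S (S x)" by blast
  have "(norm (S (x - v)))\<^sup>2 = (x - v) \<bullet> S (S (x - v))"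
    by (simp only: power2_norm_eq_inner sym)
  also have "\<dots> = 0" by (simp add: S.diff v(2))
  finally have "S (x - v) = 0" by simp
  moreover from this have "S v = S x" by (simp add: S.diff)
  ultimately show ?thesis using gap_R[OF v(1)] by (intro exI[of _ "x - v"]) auto
qed

section \<open>The Hilbert space of square-summable sequences\<close>

lemma ell2_zero: "(\<lambda>n. 0) \<in> ell2"
  by (simp add: ell2_def)

lemma ell2_mono:
  assumes "v \<in> ell2" "\<And>n. (cmod (u n))\<^sup>2 \<le> K * (cmod (v n))\<^sup>2"
  shows "u \<in> ell2"
proof -
  have "(\<lambda>n. K * (cmod (v n))\<^sup>2) summable_on UNIV"
    using assms(1) by (simp add: ell2_def summable_on_cmult_right)
  then show ?thesis unfolding ell2_def mem_Collect_eq
    by (rule summable_on_comparison_test) (use assms(2) in auto)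
qed

lemma ell2_add:
  assumes "u \<in> ell2" "v \<in> ell2"
  shows "(\<lambda>n. u n + v n) \<in> ell2"
proof -
  have "(\<lambda>n. 2 * ((cmod (u n))\<^sup>2 + (cmod (v n))\<^sup>2)) summable_on UNIV"
    using assms by (intro summable_on_cmult_right summable_on_add) (auto simp: ell2_def)
  then show ?thesis unfolding ell2_def mem_Collect_eq
  proof (rule summable_on_comparison_test)
    fix n
    have "(cmod (u n + v n))\<^sup>2 \<le> (cmod (u n) + cmod (v n))\<^sup>2"
      by (intro power_mono norm_triangle_ineq) auto
    also have "\<dots> \<le> 2 * ((cmod (u n))\<^sup>2 + (cmod (v n))\<^sup>2)"
      using sum_squares_bound[of "cmod (u n)" "cmod (v n)"] by (simp add: power2_sum)
    finally show "(cmod (u n + v n))\<^sup>2 \<le> 2 * ((cmod (u n))\<^sup>2 + (cmod (v n))\<^sup>2)" .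
  qed auto
qed

lemma ell2_mult_bounded:
  assumes "bounded (range \<phi>)" "u \<in> ell2"
  shows "(\<lambda>n. \<phi> n * u n) \<in> ell2"
proof -
  obtain K where K: "\<And>n. cmod (\<phi> n) \<le> K" using assms(1) by (auto simp: bounded_iff)
  show ?thesis
  proof (rule ell2_mono[OF assms(2)])
    fix n
    have "(cmod (\<phi> n))\<^sup>2 \<le> K\<^sup>2" using K[of n] by (intro power_mono) auto
    then show "(cmod (\<phi> n * u n))\<^sup>2 \<le> K\<^sup>2 * (cmod (u n))\<^sup>2"
      by (simp add: norm_mult power_mult_distrib mult_right_mono)
  qed
qed

lemma ell2_scale: "u \<in> ell2 \<Longrightarrow> (\<lambda>n. c * u n) \<in> ell2"
  using ell2_mult_bounded[of "\<lambda>_. c"] by simp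

lemma bij_shift_int: "bij (\<lambda>n. n + k :: int)"
  by (rule bij_betwI[where g = "\<lambda>n. n - k"]) auto

lemma ell2_shift: "u \<in> ell2 \<Longrightarrow> (\<lambda>n. u (n + k)) \<in> ell2"
  unfolding ell2_def mem_Collect_eq
  by (subst summable_on_reindex_bij_betw[OF bij_shift_int, of "\<lambda>n. (cmod (u n))\<^sup>2"])

lemma ell2_inner_summable:
  assumes "u \<in> ell2" "v \<in> ell2"
  shows "(\<lambda>n. u n \<bullet> v n) summable_on UNIV"
proof -
  have "(\<lambda>n. (cmod (u n + v n))\<^sup>2 + - (cmod (u n))\<^sup>2 + - (cmod (v n))\<^sup>2) summable_on UNIV"
    using ell2_add[OF assms] assms
    by (intro summable_on_add) (simp_all add: ell2_def summable_on_uminus)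
  then have "(\<lambda>n. (1/2) * ((cmod (u n + v n))\<^sup>2 + - (cmod (u n))\<^sup>2 + - (cmod (v n))\<^sup>2)) summable_on UNIV"
    by (rule summable_on_cmult_right)
  also have "(\<lambda>n. (1/2) * ((cmod (u n + v n))\<^sup>2 + - (cmod (u n))\<^sup>2 + - (cmod (v n))\<^sup>2)) = (\<lambda>n. u n \<bullet> v n)"
    by (rule ext) (simp add: dot_norm)
  finally show ?thesis .
qed

text \<open>Turning the carrier into a type makes it an instance of \<open>real_inner\<close> and
  \<open>complete_space\<close>, so that limits, bounded linear maps and the results of the previous
  section apply.\<close>

typedef l2 = ell2 morphisms coord l2_of
  using ell2_zero by blast

setup_lifting type_definition_l2

lemma l2_eqI: "(\<And>n. coord x n = coord y n) \<Longrightarrow> x = y"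
  by (simp add: coord_inject[symmetric] fun_eq_iff)

instantiation l2 :: real_vector
begin

lift_definition zero_l2 :: l2 is "\<lambda>n. 0" by (rule ell2_zero)
lift_definition plus_l2 :: "l2 \<Rightarrow> l2 \<Rightarrow> l2" is "\<lambda>u v n. u n + v n" by (rule ell2_add)
lift_definition minus_l2 :: "l2 \<Rightarrow> l2 \<Rightarrow> l2" is "\<lambda>u v n. u n - v n"
  using ell2_add[OF _ ell2_scale[of _ "-1"]] by simp
lift_definition uminus_l2 :: "l2 \<Rightarrow> l2" is "\<lambda>u n. - u n"
  using ell2_scale[of _ "-1"] by simp
lift_definition scaleR_l2 :: "real \<Rightarrow> l2 \<Rightarrow> l2" is "\<lambda>r u n. r *\<^sub>R u n"
  by (simp add: scaleR_conv_of_real ell2_scale)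

instance
  by standard (transfer, simp add: algebra_simps)+

end

instantiation l2 :: real_inner
begin

text \<open>On complex values the product is the real part of \<open>u n * cnj (v n)\<close>, so
  \<open>l2\<close> becomes a real Hilbert space. Complex scalars enter later as the operators
  \<open>cscale\<close>.\<close>

lift_definition inner_l2 :: "l2 \<Rightarrow> l2 \<Rightarrow> real" is "\<lambda>u v. \<Sum>\<^sub>\<infinity>n. u n \<bullet> v n" .

definition norm_l2 :: "l2 \<Rightarrow> real" where "norm_l2 x = sqrt (x \<bullet> x)"
definition dist_l2 :: "l2 \<Rightarrow> l2 \<Rightarrow> real" where "dist_l2 x y = norm (x - y)"
definition sgn_l2 :: "l2 \<Rightarrow> l2" where "sgn_l2 x = x /\<^sub>R norm x"
definition uniformity_l2 :: "(l2 \<times> l2) filter" where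
  "uniformity_l2 = (INF e\<in>{0<..}. principal {(x, y). dist x y < e})"
definition open_l2 :: "l2 set \<Rightarrow> bool" where
  "open_l2 U = (\<forall>x\<in>U. eventually (\<lambda>(x', y). x' = x \<longrightarrow> y \<in> U) uniformity)"

instance
proof
  fix x y z :: l2 and r :: real and U :: "l2 set"
  show "dist x y = norm (x - y)" "sgn x = x /\<^sub>R norm x" "norm x = sqrt (x \<bullet> x)"
    "uniformity = (INF e\<in>{0<..}. principal {(x, y). dist x y < (e :: real)} :: (l2 \<times> l2) filter)"
    "open U = (\<forall>x\<in>U. eventually (\<lambda>(x', y). x' = x \<longrightarrow> y \<in> U) uniformity)"
    by (rule dist_l2_def sgn_l2_def norm_l2_def uniformity_l2_def open_l2_def)+
  show "x \<bullet> y = y \<bullet> x"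
    by transfer (simp add: inner_commute)
  show "(x + y) \<bullet> z = x \<bullet> z + y \<bullet> z"
    by transfer (simp add: inner_add_left infsum_add ell2_inner_summable)
  show "(r *\<^sub>R x) \<bullet> y = r * (x \<bullet> y)"
    by transfer (simp add: infsum_cmult_right')
  show "0 \<le> x \<bullet> x"
    by transfer (simp add: infsum_nonneg)
  show "x \<bullet> x = 0 \<longleftrightarrow> x = 0"
  proof transfer
    fix u :: "int \<Rightarrow> complex" assume u: "u \<in> ell2"
    show "(\<Sum>\<^sub>\<infinity>n. u n \<bullet> u n) = 0 \<longleftrightarrow> u = (\<lambda>n. 0)"
    proof
      assume *: "(\<Sum>\<^sub>\<infinity>n. u n \<bullet> u n) = 0"
      show "u = (\<lambda>n. 0)"
      proof
        fix n
        have "u n \<bullet> u n = 0"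
          by (rule nonneg_infsum_le_0D[of "\<lambda>n. u n \<bullet> u n" UNIV]) (use * ell2_inner_summable[OF u u] in auto)
        then show "u n = 0" by simp
      qed
    qed simp
  qed
qed

end

lemma coord_simps [simp]:
  "coord 0 n = 0" "coord (x + y) n = coord x n + coord y n" "coord (x - y) n = coord x n - coord y n"
  "coord (- x) n = - coord x n" "coord (r *\<^sub>R x) n = of_real r * coord x n"
  by (transfer, simp add: scaleR_conv_of_real)+

lemma norm_has_sum: "((\<lambda>n. (cmod (coord x n))\<^sup>2) has_sum (norm x)\<^sup>2) UNIV"
proof -
  have "(norm x)\<^sup>2 = (\<Sum>\<^sub>\<infinity>n. (cmod (coord x n))\<^sup>2)"
    unfolding power2_norm_eq_inner by transfer rule
  then show ?thesis using coord[of x] by (simp add: ell2_def)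
qed

lemma norm_eq_ell2_norm: "norm x = ell2_norm (coord x)"
  using infsumI[OF norm_has_sum, of x] by (simp add: ell2_norm_def)

lemma sum_coord_le_norm: "finite F \<Longrightarrow> (\<Sum>n\<in>F. (cmod (coord x n))\<^sup>2) \<le> (norm x)\<^sup>2"
  by (rule finite_sum_le_has_sum[OF norm_has_sum]) auto

lemma coord_le_norm: "cmod (coord x n) \<le> norm x"
  by (rule power2_le_imp_le) (use sum_coord_le_norm[of "{n}" x] in auto)

lemma norm_le_mult:
  assumes "K \<ge> 0" "\<And>n. cmod (coord x n) \<le> K * cmod (coord y n)"
  shows "norm x \<le> K * norm y"
proof -
  have "(norm x)\<^sup>2 \<le> K\<^sup>2 * (norm y)\<^sup>2"
  proof (rule has_sum_mono[OF norm_has_sum has_sum_cmult_right[OF norm_has_sum]])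
    fix n show "(cmod (coord x n))\<^sup>2 \<le> K\<^sup>2 * (cmod (coord y n))\<^sup>2"
      using power_mono[OF assms(2)[of n], of 2] by (simp add: power_mult_distrib)
  qed
  then have "(norm x)\<^sup>2 \<le> (K * norm y)\<^sup>2" by (simp only: power_mult_distrib)
  then show ?thesis by (rule power2_le_imp_le) (use assms(1) in simp)
qed

lemma norm_finite_support:
  assumes "finite F" "\<And>n. n \<notin> F \<Longrightarrow> coord x n = 0"
  shows "(norm x)\<^sup>2 = (\<Sum>n\<in>F. (cmod (coord x n))\<^sup>2)"
proof -
  have "((\<lambda>n. (cmod (coord x n))\<^sup>2) has_sum (norm x)\<^sup>2) F"
    by (rule has_sum_cong_neutral[THEN iffD1, OF _ _ _ norm_has_sum]) (use assms(2) in auto)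
  then show ?thesis using has_sum_unique has_sum_finite[OF assms(1)] by blast
qed

text \<open>The candidate is the coordinatewise limit \<open>u\<close>. Bounds on finite partial
  sums of \<open>X i - X j\<close> pass to the limit in \<open>j\<close>, so the difference of
  \<open>X i\<close> and \<open>u\<close> is square-summable and small.\<close>

instance l2 :: complete_space
proof
  fix X :: "nat \<Rightarrow> l2" assume "Cauchy X"
  have "Cauchy (\<lambda>j. coord (X j) n)" for n
    using \<open>Cauchy X\<close> unfolding Cauchy_def dist_norm
    by (metis coord_le_norm coord_simps(3) order_le_less_trans)
  then have "\<exists>l. (\<lambda>j. coord (X j) n) \<longlonglongrightarrow> l" for n
    by (simp add: Cauchy_convergent_iff convergent_def)
  then obtain u where u: "\<And>n. (\<lambda>j. coord (X j) n) \<longlonglongrightarrow> u n" by metis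
  have fatou: "(\<Sum>n\<in>F. (cmod (coord (X i) n - u n))\<^sup>2) \<le> e\<^sup>2"
    if "finite F" "\<And>j. j \<ge> N \<Longrightarrow> norm (X i - X j) \<le> e" for F i N e
  proof (rule LIMSEQ_le_const2)
    show "(\<lambda>j. \<Sum>n\<in>F. (cmod (coord (X i) n - coord (X j) n))\<^sup>2) \<longlonglongrightarrow> (\<Sum>n\<in>F. (cmod (coord (X i) n - u n))\<^sup>2)"
      by (intro tendsto_intros u)
    have "(\<Sum>n\<in>F. (cmod (coord (X i) n - coord (X j) n))\<^sup>2) \<le> e\<^sup>2" if "j \<ge> N" for j
      using sum_coord_le_norm[OF \<open>finite F\<close>, of "X i - X j"] power_mono[OF \<open>\<And>j. j \<ge> N \<Longrightarrow> norm (X i - X j) \<le> e\<close>[OF that], of 2]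
      by simp
    then show "\<exists>N. \<forall>j\<ge>N. (\<Sum>n\<in>F. (cmod (coord (X i) n - coord (X j) n))\<^sup>2) \<le> e\<^sup>2" by blast
  qed
  have mem: "(\<lambda>n. coord (X i) n - u n) \<in> ell2" if "\<And>j. j \<ge> N \<Longrightarrow> norm (X i - X j) \<le> e" for i N e
    unfolding ell2_def mem_Collect_eq
    by (rule nonneg_bdd_above_summable_on) (auto intro!: bdd_aboveI[of _ "e\<^sup>2"] fatou that)
  obtain N1 where "\<And>i j. i \<ge> N1 \<Longrightarrow> j \<ge> N1 \<Longrightarrow> norm (X i - X j) < 1"
    using \<open>Cauchy X\<close> unfolding Cauchy_def dist_norm by (metis zero_less_one)
  then have "(\<lambda>n. coord (X N1) n - u n) \<in> ell2" by (intro mem[of N1 _ 1]) (auto intro: less_imp_le)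
  from ell2_add[OF coord[of "X N1"] ell2_scale[OF this, of "-1"]] have "u \<in> ell2" by simp
  then have cu: "coord (l2_of u) = u" by (rule l2_of_inverse)
  have "X \<longlonglongrightarrow> l2_of u"
  proof (rule LIMSEQ_I)
    fix r :: real assume "r > 0"
    then obtain N where N: "\<And>i j. i \<ge> N \<Longrightarrow> j \<ge> N \<Longrightarrow> norm (X i - X j) < r / 2"
      using \<open>Cauchy X\<close> unfolding Cauchy_def dist_norm by (metis half_gt_zero)
    have "norm (X i - l2_of u) < r" if "i \<ge> N" for i
    proof -
      have "(norm (X i - l2_of u))\<^sup>2 \<le> (r / 2)\<^sup>2"
      proof (rule has_sum_le_finite_sums[OF norm_has_sum])
        fix F :: "int set" assume "finite F"
        then show "(\<Sum>n\<in>F. (cmod (coord (X i - l2_of u) n))\<^sup>2) \<le> (r / 2)\<^sup>2"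
          using fatou[OF _ less_imp_le[OF N[OF that]]] by (simp add: cu)
      qed
      then have "norm (X i - l2_of u) \<le> r / 2" by (rule power2_le_imp_le) (use \<open>r > 0\<close> in simp)
      then show ?thesis using \<open>r > 0\<close> by simp
    qed
    then show "\<exists>N. \<forall>i\<ge>N. norm (X i - l2_of u) < r" by blast
  qed
  then show "convergent X" by (auto simp: convergent_def)
qed

section \<open>Shifts and multiplication operators\<close>

lift_definition shift :: "int \<Rightarrow> l2 \<Rightarrow> l2" is "\<lambda>k u n. u (n + k)" by (rule ell2_shift)

lemma coord_shift [simp]: "coord (shift k x) n = coord x (n + k)"
  by transfer simp

text \<open>An unbounded \<open>\<phi>\<close> could lead out of \<open>ell2\<close>; the value 0 in
  that case makes the map total on \<open>l2\<close>.\<close>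

lift_definition mulf :: "(int \<Rightarrow> complex) \<Rightarrow> l2 \<Rightarrow> l2"
  is "\<lambda>\<phi> u n. if bounded (range \<phi>) then \<phi> n * u n else 0"
  subgoal for \<phi> u
    by (cases "bounded (range \<phi>)") (simp_all add: ell2_zero ell2_mult_bounded)
  done

lemma coord_mulf [simp]: "bounded (range \<phi>) \<Longrightarrow> coord (mulf \<phi> x) n = \<phi> n * coord x n"
  by transfer simp

lemma norm_shift [simp]: "norm (shift k x) = norm x"
proof -
  have "((\<lambda>n. (cmod (coord x (n + k)))\<^sup>2) has_sum (norm x)\<^sup>2) UNIV"
    using norm_has_sum[of x] has_sum_reindex_bij_betw[OF bij_shift_int, of "\<lambda>n. (cmod (coord x n))\<^sup>2" k] by simp
  then have "(norm (shift k x))\<^sup>2 = (norm x)\<^sup>2"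
    using norm_has_sum[of "shift k x"] has_sum_unique by fastforce
  then show ?thesis by simp
qed

lemma bounded_linear_shift: "bounded_linear (shift k)"
  by (rule bounded_linear_intro[of _ 1]) (auto intro!: l2_eqI)

lemma norm_mulf_le:
  assumes "bounded (range \<phi>)" "K \<ge> 0" "\<And>n. coord x n \<noteq> 0 \<Longrightarrow> cmod (\<phi> n) \<le> K"
  shows "norm (mulf \<phi> x) \<le> K * norm x"
proof (rule norm_le_mult[OF assms(2)])
  fix n show "cmod (coord (mulf \<phi> x) n) \<le> K * cmod (coord x n)"
    using assms by (cases "coord x n = 0") (auto simp: norm_mult intro: mult_right_mono)
qed

lemma bounded_linear_mulf:
  assumes "bounded (range \<phi>)"
  shows "bounded_linear (mulf \<phi>)"
proof -
  obtain K where K: "\<And>n. cmod (\<phi> n) \<le> K" using assms by (auto simp: bounded_iff)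
  have "0 \<le> K" using K[of 0] norm_ge_zero order_trans by blast
  show ?thesis
  proof (rule bounded_linear_intro[of _ K])
    show "norm (mulf \<phi> x) \<le> norm x * K" for x
      using norm_mulf_le[OF assms \<open>0 \<le> K\<close>, of x] K by (simp add: mult.commute)
  qed (auto intro!: l2_eqI simp: assms algebra_simps)
qed

lemma inner_eq_infsum: "x \<bullet> y = (\<Sum>\<^sub>\<infinity>n. coord x n \<bullet> coord y n)"
  by transfer rule

lemma inner_shift: "shift k x \<bullet> y = x \<bullet> shift (- k) y"
  unfolding inner_eq_infsum
  using infsum_reindex_bij_betw[OF bij_shift_int, of "\<lambda>n. coord x n \<bullet> coord y (n + - k)" k] by simp

lemma inner_mulf:
  assumes "bounded (range \<phi>)"
  shows "mulf \<phi> x \<bullet> y = x \<bullet> mulf (\<lambda>n. cnj (\<phi> n)) y"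
proof -
  have "bounded (range (\<lambda>n. cnj (\<phi> n)))" using assms by (auto simp: bounded_iff)
  then show ?thesis
    unfolding inner_eq_infsum using assms by (simp add: inner_complex_def algebra_simps)
qed

text \<open>\<open>l2\<close> carries only real scalars, so a complex multiple is expressed by the
  multiplication operator of a constant sequence.\<close>

abbreviation cscale :: "complex \<Rightarrow> l2 \<Rightarrow> l2" where "cscale c \<equiv> mulf (\<lambda>_. c)"

lemma bounded_range_const [simp]: "bounded (range (\<lambda>_. c))"
  by (auto simp: bounded_iff)

lemma norm_cscale [simp]: "norm (cscale c x) = cmod c * norm x"
proof -
  have "((\<lambda>n. (cmod c)\<^sup>2 * (cmod (coord x n))\<^sup>2) has_sum (cmod c)\<^sup>2 * (norm x)\<^sup>2) UNIV"
    by (rule has_sum_cmult_right[OF norm_has_sum])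
  then have "(norm (cscale c x))\<^sup>2 = (cmod c * norm x)\<^sup>2"
    using norm_has_sum[of "cscale c x"] has_sum_unique
    by (fastforce simp: norm_mult power_mult_distrib)
  then show ?thesis by (simp add: power2_eq_iff_nonneg)
qed

section \<open>Discrete Schroedinger operators\<close>

definition jacobi :: "(int \<Rightarrow> complex) \<Rightarrow> l2 \<Rightarrow> l2" where
  "jacobi \<phi> x = shift 1 x + shift (- 1) x + mulf \<phi> x"

text \<open>The spectral parameter is absorbed into the potential, so that
  \<open>jacobi (potential V z)\<close> represents h0 + V - z on \<open>l2\<close>.\<close>

abbreviation potential :: "(int \<Rightarrow> real) \<Rightarrow> complex \<Rightarrow> int \<Rightarrow> complex" where
  "potential V z \<equiv> (\<lambda>n. of_real (V n) - z)"

lemma bounded_potential: "bounded (range V) \<Longrightarrow> bounded (range (potential V z))"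
proof -
  assume "bounded (range V)"
  then obtain K where K: "\<bar>V n\<bar> \<le> K" for n by (auto simp: bounded_iff)
  have "cmod (potential V z n) \<le> K + cmod z" for n
    using norm_triangle_ineq4[of "of_real (V n)" z] K[of n] by simp
  then show ?thesis by (auto simp: bounded_iff)
qed

lemma coord_jacobi:
  "bounded (range \<phi>) \<Longrightarrow> coord (jacobi \<phi> x) n = coord x (n + 1) + coord x (n - 1) + \<phi> n * coord x n"
  by (simp add: jacobi_def)

lemma coord_jacobi_potential:
  assumes "bounded (range V)"
  shows "coord (jacobi (potential V z) x) = op_shift (op_add h0 (mult_op V)) z (coord x)"
  by (rule ext)
     (simp add: coord_jacobi bounded_potential assms op_shift_def op_add_def h0_def mult_op_def algebra_simps)

lemma bounded_linear_jacobi: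
  assumes "bounded (range \<phi>)"
  shows "bounded_linear (jacobi \<phi>)"
  unfolding jacobi_def by (intro bounded_linear_add bounded_linear_shift bounded_linear_mulf assms)

lemma inner_jacobi:
  assumes "bounded (range \<phi>)"
  shows "jacobi \<phi> x \<bullet> y = x \<bullet> jacobi (\<lambda>n. cnj (\<phi> n)) y"
  unfolding jacobi_def inner_add_left inner_add_right
  by (simp add: inner_shift inner_mulf assms)

lemma inner_jacobi_potential:
  "bounded (range V) \<Longrightarrow> jacobi (potential V z) x \<bullet> y = x \<bullet> jacobi (potential V (cnj z)) y"
  by (simp add: inner_jacobi bounded_potential)

lemma symmetric_jacobi:
  "bounded (range V) \<Longrightarrow> jacobi (potential V (of_real r)) x \<bullet> y = x \<bullet> jacobi (potential V (of_real r)) y"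
  by (simp add: inner_jacobi_potential)

lemma jacobi_cscale:
  "bounded (range \<phi>) \<Longrightarrow> jacobi \<phi> (cscale c x) = cscale c (jacobi \<phi> x)"
  by (rule l2_eqI) (simp add: coord_jacobi algebra_simps)

lemma jacobi_shift:
  assumes "bounded (range \<phi>)"
  shows "jacobi \<phi> (shift k x) = shift k (jacobi (\<lambda>n. \<phi> (n - k)) x)"
proof -
  have "bounded (range (\<lambda>n. \<phi> (n - k)))"
    by (rule bounded_subset[OF assms]) auto
  then show ?thesis by (intro l2_eqI) (simp add: coord_jacobi assms algebra_simps)
qed

lemma jacobi_potential_diff:
  "bounded (range V) \<Longrightarrow> jacobi (potential V w) x = jacobi (potential V z) x - cscale (w - z) x"
  by (rule l2_eqI) (simp add: coord_jacobi bounded_potential algebra_simps)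

text \<open>Let \<open>T\<close> be the operator at the real part of \<open>z\<close> and
  \<open>w\<close> the multiple of \<open>x\<close> by the imaginary unit. The operator at
  \<open>z\<close> sends \<open>x\<close> to \<open>T x - Im z *\<^sub>R w\<close>. Symmetry of
  \<open>T\<close> makes \<open>w\<close> orthogonal to \<open>T x\<close> in the real inner
  product, and Pythagoras applies.\<close>

lemma norm_jacobi_ge_Im:
  assumes V: "bounded (range V)"
  shows "\<bar>Im z\<bar> * norm x \<le> norm (jacobi (potential V z) x)"
proof -
  define T where "T = jacobi (potential V (of_real (Re z)))"
  define w where "w = cscale \<i> x"
  have "w \<bullet> T x = T w \<bullet> x"
    unfolding T_def by (simp add: symmetric_jacobi V)
  also have "T w = cscale \<i> (T x)"
    by (simp add: T_def w_def jacobi_cscale bounded_potential V)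
  also have "\<dots> \<bullet> x = T x \<bullet> - w"
  proof -
    have "cscale (cnj \<i>) x = - w" by (rule l2_eqI) (simp add: w_def)
    then show ?thesis by (simp add: inner_mulf)
  qed
  finally have "w \<bullet> T x = 0" by (simp add: inner_commute)
  have "cscale (z - of_real (Re z)) x = Im z *\<^sub>R w"
    by (rule l2_eqI) (simp add: w_def complex_eq_iff)
  then have eq: "jacobi (potential V z) x = T x - Im z *\<^sub>R w"
    using jacobi_potential_diff[OF V, of z x "of_real (Re z)"] by (simp add: T_def)
  have "(norm (jacobi (potential V z) x))\<^sup>2 = (norm (T x))\<^sup>2 + (\<bar>Im z\<bar> * norm w)\<^sup>2"
    unfolding eq power_mult_distrib power2_norm_eq_inner using \<open>w \<bullet> T x = 0\<close>
    by (simp add: inner_diff_left inner_diff_right inner_commute[of "T x" w] power2_eq_square)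
  moreover have "norm w = norm x" by (simp add: w_def)
  ultimately have "(\<bar>Im z\<bar> * norm x)\<^sup>2 \<le> (norm (jacobi (potential V z) x))\<^sup>2" by simp
  then show ?thesis by (rule power2_le_imp_le) simp
qed

section \<open>Lower bounds and the spectrum\<close>

definition bounded_below :: "('a::real_normed_vector \<Rightarrow> 'b::real_normed_vector) \<Rightarrow> bool" where
  "bounded_below S \<longleftrightarrow> (\<exists>c>0. \<forall>x. c * norm x \<le> norm (S x))"

lemma bounded_below_nonreal:
  "bounded (range V) \<Longrightarrow> Im z \<noteq> 0 \<Longrightarrow> bounded_below (jacobi (potential V z))"
  unfolding bounded_below_def using norm_jacobi_ge_Im by (intro exI[of _ "\<bar>Im z\<bar>"]) auto

text \<open>With \<open>S'\<close> the adjoint, \<open>x \<bullet> S (S' x)\<close> is the square of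
  \<open>norm (S' x)\<close>, so the composition is coercive and hence onto. The lower bound for
  \<open>S'\<close> comes from \<open>S' = S\<close> if \<open>z\<close> is real and from the
  imaginary part otherwise.\<close>

lemma jacobi_surj:
  assumes V: "bounded (range V)" and below: "bounded_below (jacobi (potential V z))"
  shows "\<exists>x. jacobi (potential V z) x = y"
proof -
  define S where "S = jacobi (potential V z)"
  define S' where "S' = jacobi (potential V (cnj z))"
  have S: "bounded_linear S" "bounded_linear S'"
    by (simp_all add: S_def S'_def bounded_linear_jacobi bounded_potential V)
  have "bounded_below S'"
  proof (cases "Im z = 0")
    case True
    then have "cnj z = z" by (simp add: complex_eq_iff)
    then show ?thesis using below by (simp add: S'_def)
  qed (simp add: S'_def bounded_below_nonreal V)
  then obtain c where c: "c > 0" "\<And>x. c * norm x \<le> norm (S' x)"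
    unfolding bounded_below_def by blast
  have "\<exists>x\<in>UNIV. S (S' x) = y"
  proof (rule coercive_surj_on)
    show "bounded_linear (\<lambda>x. S (S' x))" by (rule bounded_linear_compose[OF S])
    show "c\<^sup>2 > 0" using c by simp
    fix x
    have "(c * norm x)\<^sup>2 \<le> (norm (S' x))\<^sup>2" by (rule power_mono[OF c(2)]) (use c(1) in simp)
    also have "\<dots> = x \<bullet> S (S' x)"
      using inner_jacobi_potential[OF V, of "cnj z"] by (simp add: S_def S'_def power2_norm_eq_inner)
    finally show "c\<^sup>2 * (norm x)\<^sup>2 \<le> x \<bullet> S (S' x)" by (simp only: power_mult_distrib)
  qed auto
  then show ?thesis by (auto simp: S_def)
qed

text \<open>This reduces all questions about the spectrum to lower bounds. A lower bound gives
  injectivity and bounds the inverse; surjectivity is \<open>jacobi_surj\<close>.\<close>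

lemma spectrum_iff_not_bounded_below:
  assumes V: "bounded (range V)"
  shows "z \<in> ell2_spectrum (op_add h0 (mult_op V)) \<longleftrightarrow> \<not> bounded_below (jacobi (potential V z))"
proof -
  define T where "T = op_shift (op_add h0 (mult_op V)) z"
  define S where "S = jacobi (potential V z)"
  have S: "bounded_linear S"
    by (simp add: S_def bounded_linear_jacobi bounded_potential V)
  interpret S: bounded_linear S by (rule S)
  have T: "coord (S x) = T (coord x)" for x
    by (simp add: S_def T_def coord_jacobi_potential V)
  have "(\<exists>R. ell2_bounded_op R \<and> (\<forall>u\<in>ell2. R (T u) = u \<and> T (R u) = u)) \<longleftrightarrow> bounded_below S"
  proof
    assume "\<exists>R. ell2_bounded_op R \<and> (\<forall>u\<in>ell2. R (T u) = u \<and> T (R u) = u)"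
    then obtain R where R: "ell2_bounded_op R" "\<And>u. u \<in> ell2 \<Longrightarrow> R (T u) = u" by blast
    from R(1) obtain C where C: "\<And>u. u \<in> ell2 \<Longrightarrow> ell2_norm (R u) \<le> C * ell2_norm u"
      unfolding ell2_bounded_op_def by blast
    \<comment> \<open>The sign of \<open>C\<close> is unknown; \<open>max C 1\<close> can be
      inverted.\<close>
    have "norm x \<le> max C 1 * norm (S x)" for x
    proof -
      have "norm x = ell2_norm (R (coord (S x)))"
        by (simp add: T R(2) coord norm_eq_ell2_norm)
      also have "\<dots> \<le> C * norm (S x)" by (simp add: C coord norm_eq_ell2_norm)
      also have "\<dots> \<le> max C 1 * norm (S x)" by (rule mult_right_mono) auto
      finally show ?thesis .
    qed
    then show "bounded_below S"
      unfolding bounded_below_def by (intro exI[of _ "1 / max C 1"]) (auto simp: field_simps)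
  next
    assume below: "bounded_below S"
    then obtain c where c: "c > 0" "\<And>x. c * norm x \<le> norm (S x)" unfolding bounded_below_def by blast
    have inj: "x = y" if "S x = S y" for x y
    proof -
      have "c * norm (x - y) \<le> 0" using c(2)[of "x - y"] that by (simp add: S.diff)
      then show ?thesis using c(1) by (simp add: mult_le_0_iff)
    qed
    have "\<exists>x. S x = y" for y
      using jacobi_surj[OF V, of z] below by (simp add: S_def)
    then obtain G where G: "\<And>y. S (G y) = y" by metis
    define R where "R u = coord (G (l2_of u))" for u
    have GS: "G (S x) = x" for x by (rule inj) (rule G)
    show "\<exists>R. ell2_bounded_op R \<and> (\<forall>u\<in>ell2. R (T u) = u \<and> T (R u) = u)"
    proof (intro exI[of _ R] conjI ballI)
      fix u assume u: "u \<in> ell2"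
      show "R (T u) = u"
        using T[of "l2_of u"] coord_inverse[of "S (l2_of u)"] u by (simp add: R_def l2_of_inverse GS)
      show "T (R u) = u"
        by (simp add: R_def G l2_of_inverse u flip: T)
    next
      show "ell2_bounded_op R"
        unfolding ell2_bounded_op_def
      proof (intro conjI ballI allI)
        fix u assume "u \<in> ell2" show "R u \<in> ell2" by (simp add: R_def coord)
      next
        fix u v assume uv: "u \<in> ell2" "v \<in> ell2"
        have "l2_of (\<lambda>n. u n + v n) = l2_of u + l2_of v"
          by (rule l2_eqI) (simp add: l2_of_inverse uv ell2_add)
        moreover have "G (l2_of u + l2_of v) = G (l2_of u) + G (l2_of v)"
          by (rule inj) (simp add: G S.add)
        ultimately show "R (\<lambda>n. u n + v n) = (\<lambda>n. R u n + R v n)"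
          by (simp add: R_def fun_eq_iff)
      next
        fix c u assume u: "u \<in> ell2"
        have "l2_of (\<lambda>n. c * u n) = cscale c (l2_of u)"
          by (rule l2_eqI) (simp add: l2_of_inverse u ell2_scale)
        moreover have "G (cscale c (l2_of u)) = cscale c (G (l2_of u))"
          by (rule inj) (simp add: G, simp add: S_def jacobi_cscale bounded_potential V, simp add: G flip: S_def)
        ultimately show "R (\<lambda>n. c * u n) = (\<lambda>n. c * R u n)"
          by (simp add: R_def fun_eq_iff)
      next
        show "\<exists>C. \<forall>u\<in>ell2. ell2_norm (R u) \<le> C * ell2_norm u"
        proof (intro exI[of _ "1 / c"] ballI)
          fix u assume u: "u \<in> ell2"
          have "ell2_norm u = norm (S (G (l2_of u)))" by (simp add: G norm_eq_ell2_norm l2_of_inverse u)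
          then show "ell2_norm (R u) \<le> 1 / c * ell2_norm u"
            using c(2)[of "G (l2_of u)"] c(1) by (simp add: R_def field_simps flip: norm_eq_ell2_norm)
        qed
      qed
    qed
  qed
  then show ?thesis unfolding ell2_spectrum_def T_def S_def mem_Collect_eq by (rule arg_cong)
qed

lemma spectrum_real:
  assumes "bounded (range V)" "z \<in> ell2_spectrum (op_add h0 (mult_op V))"
  shows "z = of_real (Re z)"
  using assms bounded_below_nonreal[of V z] by (auto simp: spectrum_iff_not_bounded_below complex_eq_iff)

section \<open>Solutions of the eigenvalue equation\<close>

lemma jacobi_kernel_unique:
  assumes \<phi>: "bounded (range \<phi>)" and x: "jacobi \<phi> x = 0" "coord x 0 = 0" "coord x 1 = 0"
  shows "x = 0"
proof -
  have rec: "coord x (n + 1) + coord x (n - 1) + \<phi> n * coord x n = 0" for n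
    using arg_cong[OF x(1), of "\<lambda>x. coord x n"] by (simp add: coord_jacobi \<phi>)
  have "coord x n = 0 \<and> coord x (n + 1) = 0" for n
  \<comment> \<open>The three-term recurrence propagates two adjacent zeros in both
    directions.\<close>
  proof (induction n rule: int_induct[where k = 0])
    case base
    then show ?case using x by simp
  next
    case (step1 i)
    then show ?case using rec[of "i + 1"] by (simp add: algebra_simps)
  next
    case (step2 i)
    then show ?case using rec[of i] by (simp add: algebra_simps)
  qed
  then show ?thesis by (intro l2_eqI) simp
qed

text \<open>The Wronskian of two solutions is constant, and it is summable if both are square-summable.\<close>

lemma jacobi_kernel_proportional:
  assumes \<phi>: "bounded (range \<phi>)" and x: "jacobi \<phi> x = 0" and y: "jacobi \<phi> y = 0" "y \<noteq> 0"
  shows "\<exists>c. x = cscale c y"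
proof -
  have rec: "coord v (n + 1) + coord v (n - 1) + \<phi> n * coord v n = 0" if "jacobi \<phi> v = 0" for v n
    using arg_cong[OF that, of "\<lambda>x. coord x n"] by (simp add: coord_jacobi \<phi>)
  define w where "w n = coord x (n + 1) * coord y n - coord x n * coord y (n + 1)" for n
  have step: "w (n + 1) = w n" for n
  proof -
    have "coord x (n + 1 + 1) + coord x n + \<phi> (n + 1) * coord x (n + 1) = 0"
      "coord y (n + 1 + 1) + coord y n + \<phi> (n + 1) * coord y (n + 1) = 0"
      using rec[OF x, of "n + 1"] rec[OF y(1), of "n + 1"] by (simp_all only: add_diff_cancel_right')
    then show ?thesis unfolding w_def by algebra
  qed
  have const: "w (int k) = w 0" for k
  proof (induction k)
    case (Suc k)
    then show ?case using step[of "int k"] by (simp add: algebra_simps)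
  qed simp
  have "w 0 = 0"
  proof (rule ccontr)
    assume "w 0 \<noteq> 0"
    \<comment> \<open>Adding up \<open>k\<close> Wronskians of equal value gives a bound independent
      of \<open>k\<close>, so the common value must vanish.\<close>
    have bound: "real k * cmod (w 0) \<le> (norm x)\<^sup>2 + (norm y)\<^sup>2" for k :: nat
    proof -
      have S: "(\<Sum>n\<in>int ` {..<k}. (cmod (coord v (n + j)))\<^sup>2) \<le> (norm v)\<^sup>2" for v j
        using sum_coord_le_norm[of "int ` {..<k}" "shift j v"] by simp
      have pointwise: "2 * cmod (w n) \<le> (cmod (coord x (n + 1)))\<^sup>2 + (cmod (coord y (n + 0)))\<^sup>2
          + (cmod (coord x (n + 0)))\<^sup>2 + (cmod (coord y (n + 1)))\<^sup>2" for n
      proof -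
        have "cmod (w n) \<le> cmod (coord x (n + 1)) * cmod (coord y n) + cmod (coord x n) * cmod (coord y (n + 1))"
          unfolding w_def by (metis norm_mult norm_triangle_ineq4)
        then show ?thesis
          using sum_squares_bound[of "cmod (coord x (n + 1))" "cmod (coord y n)"]
            sum_squares_bound[of "cmod (coord x n)" "cmod (coord y (n + 1))"] by simp
      qed
      have "2 * (real k * cmod (w 0)) = (\<Sum>n\<in>int ` {..<k}. 2 * cmod (w n))"
        by (subst sum.reindex) (auto simp: const)
      also have "\<dots> \<le> (\<Sum>n\<in>int ` {..<k}. (cmod (coord x (n + 1)))\<^sup>2 + (cmod (coord y (n + 0)))\<^sup>2
          + (cmod (coord x (n + 0)))\<^sup>2 + (cmod (coord y (n + 1)))\<^sup>2)"
        by (rule sum_mono) (rule pointwise)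
      also have "\<dots> \<le> (norm x)\<^sup>2 + (norm y)\<^sup>2 + (norm x)\<^sup>2 + (norm y)\<^sup>2"
        unfolding sum.distrib by (intro add_mono S)
      finally show ?thesis by simp
    qed
    obtain k :: nat where "(norm x)\<^sup>2 + (norm y)\<^sup>2 < real k * cmod (w 0)"
      using reals_Archimedean3[of "cmod (w 0)"] \<open>w 0 \<noteq> 0\<close> by auto
    with bound[of k] show False by simp
  qed
  \<comment> \<open>A zero Wronskian makes the data at the sites 0 and 1 proportional, and these
    determine a solution.\<close>
  then have w0: "coord x 1 * coord y 0 = coord x 0 * coord y 1" by (simp add: w_def)
  have sub: "x = cscale c y" if "coord x 0 = c * coord y 0" "coord x 1 = c * coord y 1" for c
  proof -
    have "jacobi \<phi> (x - cscale c y) = 0"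
      by (simp add: linear_diff[OF bounded_linear.linear[OF bounded_linear_jacobi[OF \<phi>]]]
          jacobi_cscale \<phi> x y) (rule l2_eqI, simp)
    then have "x - cscale c y = 0"
      by (rule jacobi_kernel_unique[OF \<phi>]) (simp_all add: that)
    then show ?thesis by simp
  qed
  consider "coord y 0 \<noteq> 0" | "coord y 1 \<noteq> 0"
    using jacobi_kernel_unique[OF \<phi> y(1)] y(2) by blast
  then show ?thesis
  proof cases
    case 1
    then show ?thesis using w0 by (intro exI[of _ "coord x 0 / coord y 0"] sub) (simp_all add: field_simps)
  next
    case 2
    then show ?thesis using w0 by (intro exI[of _ "coord x 1 / coord y 1"] sub) (simp_all add: field_simps)
  qed
qed

lemma eigenspace_finite_dimensional:
  assumes V: "bounded (range V)"
  shows "finite_dimensional (ell2_eigenspace (op_add h0 (mult_op V)) z)"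
proof -
  let ?E = "ell2_eigenspace (op_add h0 (mult_op V)) z"
  have ker: "jacobi (potential V z) (l2_of u) = 0" if "u \<in> ?E" for u
    by (rule l2_eqI, subst coord_jacobi_potential[OF V])
       (use that in \<open>simp add: ell2_eigenspace_def l2_of_inverse op_shift_def\<close>)
  show ?thesis
  proof (cases "\<exists>v\<in>?E. v \<noteq> (\<lambda>n. 0)")
    case True
    then obtain v where v: "v \<in> ?E" "v \<noteq> (\<lambda>n. 0)" by blast
    then have vl: "coord (l2_of v) = v" by (simp add: l2_of_inverse ell2_eigenspace_def)
    have "l2_of v \<noteq> 0"
    proof
      assume "l2_of v = 0"
      then have "coord (l2_of v) = (\<lambda>n. 0)" by (simp add: fun_eq_iff)
      then show False using v vl by simp
    qed
    have "\<exists>c. u = (\<lambda>n. \<Sum>b\<in>{v}. c b * b n)" if u: "u \<in> ?E" for u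
    proof -
      obtain c where "l2_of u = cscale c (l2_of v)"
        using jacobi_kernel_proportional[OF bounded_potential[OF V] ker[OF u] ker[OF v(1)] \<open>l2_of v \<noteq> 0\<close>]
        by blast
      then have "coord (l2_of u) n = coord (cscale c (l2_of v)) n" for n by simp
      then have "u n = c * v n" for n using u by (simp add: vl l2_of_inverse ell2_eigenspace_def)
      then show ?thesis by (intro exI[of _ "\<lambda>_. c"]) (simp add: fun_eq_iff)
    qed
    then show ?thesis unfolding finite_dimensional_def by (intro exI[of _ "{v}"]) simp
  next
    case False
    \<comment> \<open>The empty sum is the zero function, the only possible element of the
      eigenspace here.\<close>
    then show ?thesis unfolding finite_dimensional_def by (intro exI[of _ "{}"]) auto
  qed
qed

section \<open>Comparison of discrete Schroedinger operators\<close>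

lemma bounded_below_tendsto_zero:
  assumes "\<not> bounded_below S" "linear S"
  shows "\<exists>X. (\<forall>j::nat. norm (X j) = 1) \<and> (\<lambda>j. S (X j)) \<longlonglongrightarrow> 0"
proof -
  interpret S: linear S by fact
  have "\<exists>x. norm x = 1 \<and> norm (S x) \<le> inverse (real (Suc j))" for j
  proof -
    obtain x where x: "norm (S x) < inverse (real (Suc j)) * norm x"
      using assms(1) unfolding bounded_below_def not_ex not_all not_le de_Morgan_conj
      by (metis inverse_positive_iff_positive of_nat_0_less_iff zero_less_Suc)
    then have "x \<noteq> 0" by (auto simp: S.zero)
    then show ?thesis
      using x by (intro exI[of _ "x /\<^sub>R norm x"]) (simp add: S.scaleR field_simps)
  qed
  then obtain X where X: "\<And>j. norm (X j) = 1" "\<And>j. norm (S (X j)) \<le> inverse (real (Suc j))" by metis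
  have "(\<lambda>j. S (X j)) \<longlonglongrightarrow> 0"
    by (rule Lim_null_comparison[OF _ LIMSEQ_inverse_real_of_nat])
       (intro always_eventually allI X(2))
  then show ?thesis using X(1) by blast
qed

text \<open>Shifts commute with hopping and preserve norms, so \<open>V'\<close> can be translated
  onto the support of \<open>x\<close>. Then the two operators differ by multiplication with a
  function that is at most \<open>\<epsilon>\<close> on this support.\<close>

lemma jacobi_compare:
  assumes V: "bounded (range V)" "bounded (range V')" and "\<epsilon> \<ge> 0"
    and close: "\<And>n. coord x n \<noteq> 0 \<Longrightarrow> \<bar>V n - V' (n + k)\<bar> \<le> \<epsilon>"
  shows "\<bar>norm (jacobi (potential V z) x) - norm (jacobi (potential V' z) (shift (- k) x))\<bar> \<le> \<epsilon> * norm x"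
proof -
  define U where "U n = V' (n + k)" for n
  have U: "bounded (range U)"
    unfolding U_def by (rule bounded_subset[OF V(2)]) auto
  have "jacobi (potential V' z) (shift (- k) x) = shift (- k) (jacobi (potential U z) x)"
    by (simp add: jacobi_shift bounded_potential V U_def)
  then have "\<bar>norm (jacobi (potential V z) x) - norm (jacobi (potential V' z) (shift (- k) x))\<bar>
      \<le> norm (jacobi (potential V z) x - jacobi (potential U z) x)"
    by (simp add: norm_triangle_ineq3)
  also have "jacobi (potential V z) x - jacobi (potential U z) x = mulf (\<lambda>n. of_real (V n - U n)) x"
  proof (rule l2_eqI)
    fix n
    have "bounded (range (\<lambda>n. complex_of_real (V n - U n)))"
      using bounded_minus_comp[OF V(1) U] by (simp add: bounded_iff del: of_real_diff)
    then show "coord (jacobi (potential V z) x - jacobi (potential U z) x) n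
        = coord (mulf (\<lambda>n. of_real (V n - U n)) x) n"
      by (simp add: coord_jacobi bounded_potential V U algebra_simps)
  qed
  also have "norm \<dots> \<le> \<epsilon> * norm x"
  proof (rule norm_mulf_le)
    show "bounded (range (\<lambda>n. complex_of_real (V n - U n)))"
      using bounded_minus_comp[OF V(1) U] by (simp add: bounded_iff del: of_real_diff)
    show "cmod (complex_of_real (V n - U n)) \<le> \<epsilon>" if "coord x n \<noteq> 0" for n
      using close[OF that] by (simp add: U_def del: of_real_diff)
  qed (rule \<open>\<epsilon> \<ge> 0\<close>)
  finally show ?thesis .
qed

section \<open>Truncation to finite windows\<close>

definition cutoff :: "int set \<Rightarrow> l2 \<Rightarrow> l2" where "cutoff I = mulf (indicator I)"

lemma coord_cutoff: "coord (cutoff I x) n = (if n \<in> I then coord x n else 0)"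
proof -
  have "bounded (range (indicator I :: int \<Rightarrow> complex))"
    by (rule boundedI[of _ 1]) (auto simp: indicator_def)
  then show ?thesis by (simp add: cutoff_def)
qed

lemma norm_cutoff: "finite I \<Longrightarrow> (norm (cutoff I x))\<^sup>2 = (\<Sum>n\<in>I. (cmod (coord x n))\<^sup>2)"
  by (subst norm_finite_support[of I]) (simp_all add: coord_cutoff)

lemma cutoff_tendsto: "(\<lambda>L::nat. cutoff {- int L..int L} x) \<longlonglongrightarrow> x"
proof -
  let ?I = "\<lambda>L::nat. {- int L..int L}"
  \<comment> \<open>The truncation is orthogonal to the remainder, so Pythagoras applies.\<close>
  have split: "(norm (x - cutoff I x))\<^sup>2 = (norm x)\<^sup>2 - (\<Sum>n\<in>I. (cmod (coord x n))\<^sup>2)" if "finite I" for I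
  proof -
    have "cutoff I x \<bullet> (x - cutoff I x) = 0"
      unfolding inner_eq_infsum by (rule infsum_0) (simp add: coord_cutoff)
    then have "x \<bullet> cutoff I x = cutoff I x \<bullet> cutoff I x" by (simp add: inner_diff_right inner_commute)
    then show ?thesis
      unfolding norm_cutoff[OF that, symmetric]
      unfolding power2_norm_eq_inner
      by (simp add: inner_diff_left inner_diff_right inner_commute[of "cutoff I x" x])
  qed
  \<comment> \<open>The windows eventually contain every finite set, so the unordered sum is the
    limit of the symmetric partial sums.\<close>
  have "filterlim ?I (finite_subsets_at_top UNIV) sequentially"
    unfolding filterlim_finite_subsets_at_top
  proof (intro allI impI)
    fix F :: "int set" assume F: "finite F \<and> F \<subseteq> UNIV"
    define M where "M = Max (abs ` F)"
    have M: "\<bar>n\<bar> \<le> M" if "n \<in> F" for n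
      unfolding M_def using F that by (intro Max_ge) auto
    have "F \<subseteq> ?I L" if "L \<ge> nat M" for L
      using M that by (fastforce simp: abs_le_iff)
    then show "\<forall>\<^sub>F L in sequentially. finite (?I L) \<and> F \<subseteq> ?I L \<and> ?I L \<subseteq> UNIV"
      by (auto simp: eventually_sequentially)
  qed
  from filterlim_compose[OF norm_has_sum[of x, unfolded has_sum_def] this]
  have "(\<lambda>L. (norm x)\<^sup>2 - (\<Sum>n\<in>?I L. (cmod (coord x n))\<^sup>2)) \<longlonglongrightarrow> (norm x)\<^sup>2 - (norm x)\<^sup>2"
    by (intro tendsto_intros)
  then have "(\<lambda>L. (norm (x - cutoff (?I L) x))\<^sup>2) \<longlonglongrightarrow> 0" by (simp add: split)
  then have "(\<lambda>L. sqrt ((norm (x - cutoff (?I L) x))\<^sup>2)) \<longlonglongrightarrow> sqrt 0" by (rule tendsto_real_sqrt)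
  then have "(\<lambda>L. norm (cutoff (?I L) x - x)) \<longlonglongrightarrow> 0" by (simp add: norm_minus_commute)
  then show ?thesis by (rule tendsto_norm_zero_cancel[THEN LIM_zero_cancel])
qed

text \<open>An approximate eigenvector for \<open>V'\<close> is truncated to a window and translated
  to a distant place where \<open>V\<close> nearly repeats that window. Half of
  \<open>\<epsilon>\<close> pays for the eigenvector, half for the mismatch of the
  potentials.\<close>

lemma approximate_eigenvector_far_out:
  assumes V: "bounded (range V)" "bounded (range V')"
    and not_below: "\<not> bounded_below (jacobi (potential V' z))"
    and recur: "\<And>L N \<epsilon>. \<epsilon> > 0 \<Longrightarrow> \<exists>n. \<bar>n\<bar> > N \<and> (\<forall>m. \<bar>m\<bar> \<le> int L \<longrightarrow> \<bar>V (n + m) - V' m\<bar> \<le> \<epsilon>)"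
    and "\<epsilon> > 0"
  shows "\<exists>x M. norm x = 1 \<and> (\<forall>n. coord x n \<noteq> 0 \<longrightarrow> N < \<bar>n\<bar> \<and> \<bar>n\<bar> \<le> M) \<and>
    norm (jacobi (potential V z) x) \<le> \<epsilon>"
proof -
  interpret S': bounded_linear "jacobi (potential V' z)"
    by (rule bounded_linear_jacobi[OF bounded_potential[OF V(2)]])
  interpret S: bounded_linear "jacobi (potential V z)"
    by (rule bounded_linear_jacobi[OF bounded_potential[OF V(1)]])
  have "\<epsilon> / 2 > 0" using \<open>\<epsilon> > 0\<close> by simp
  then obtain x where x: "norm (jacobi (potential V' z) x) < \<epsilon> / 2 * norm x"
    using not_below unfolding bounded_below_def by (meson not_le)
  define c where "c L = cutoff {- int L..int L} x" for L :: nat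
  \<comment> \<open>The inequality for \<open>x\<close> is strict, so it survives truncation to a
    large window.\<close>
  have "(\<lambda>L. \<epsilon> / 2 * norm (c L) - norm (jacobi (potential V' z) (c L)))
      \<longlonglongrightarrow> \<epsilon> / 2 * norm x - norm (jacobi (potential V' z) x)"
    unfolding c_def by (intro tendsto_intros S'.tendsto cutoff_tendsto)
  from order_tendstoD(1)[OF this, of 0] x
  obtain L where L: "norm (jacobi (potential V' z) (c L)) < \<epsilon> / 2 * norm (c L)"
    by (auto simp: eventually_sequentially)
  \<comment> \<open>The extra \<open>int L\<close> keeps the translated window of radius
    \<open>L\<close> away from all sites of absolute value at most \<open>N\<close>.\<close>
  obtain n where n: "\<bar>n\<bar> > N + int L" "\<And>m. \<bar>m\<bar> \<le> int L \<Longrightarrow> \<bar>V (n + m) - V' m\<bar> \<le> \<epsilon> / 2"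
    using recur[OF \<open>\<epsilon> / 2 > 0\<close>, of "N + int L" L] by blast
  define y where "y = shift (- n) (c L)"
  have supp: "\<bar>j - n\<bar> \<le> int L" if "coord y j \<noteq> 0" for j
    using that by (auto simp: y_def c_def coord_cutoff split: if_splits)
  have "\<bar>norm (jacobi (potential V z) y) - norm (jacobi (potential V' z) (shift (- (- n)) y))\<bar> \<le> \<epsilon> / 2 * norm y"
  proof (rule jacobi_compare[OF V])
    fix j assume "coord y j \<noteq> 0"
    then show "\<bar>V j - V' (j + - n)\<bar> \<le> \<epsilon> / 2" using n(2)[OF supp] by simp
  qed (use \<open>\<epsilon> > 0\<close> in simp)
  moreover have "shift (- (- n)) y = c L" by (rule l2_eqI) (simp add: y_def)
  moreover have "norm y = norm (c L)" by (simp add: y_def)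
  ultimately have "norm (jacobi (potential V z) y) \<le> norm (jacobi (potential V' z) (c L)) + \<epsilon> / 2 * norm y"
    by (simp only: abs_le_iff) linarith
  also have "\<dots> < \<epsilon> / 2 * norm y + \<epsilon> / 2 * norm y"
    using L \<open>norm y = norm (c L)\<close> by simp
  finally have y: "norm (jacobi (potential V z) y) < \<epsilon> * norm y" by simp
  then have "y \<noteq> 0" by (auto simp: S.zero)
  show ?thesis
  proof (intro exI[of _ "y /\<^sub>R norm y"] exI[of _ "\<bar>n\<bar> + int L"] conjI allI impI)
    show "norm (y /\<^sub>R norm y) = 1" using \<open>y \<noteq> 0\<close> by simp
    show "norm (jacobi (potential V z) (y /\<^sub>R norm y)) \<le> \<epsilon>"
      using y \<open>y \<noteq> 0\<close> by (simp add: S.scaleR field_simps)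
    fix j assume "coord (y /\<^sub>R norm y) j \<noteq> 0"
    then have "\<bar>j - n\<bar> \<le> int L" by (intro supp) simp
    then show "N < \<bar>j\<bar>" "\<bar>j\<bar> \<le> \<bar>n\<bar> + int L" using n(1) by linarith+
  qed
qed

text \<open>An isolated point of the spectrum would be an eigenvalue with eigenvectors near two approximate
  eigenvectors with disjoint supports, but its eigenvectors are proportional.\<close>

lemma spectrum_subset_essential_spectrum:
  assumes V: "bounded (range V)" "bounded (range V')"
    and recur: "\<And>L N \<epsilon>. \<epsilon> > 0 \<Longrightarrow> \<exists>n. \<bar>n\<bar> > N \<and> (\<forall>m. \<bar>m\<bar> \<le> int L \<longrightarrow> \<bar>V (n + m) - V' m\<bar> \<le> \<epsilon>)"
  shows "ell2_spectrum (op_add h0 (mult_op V')) \<subseteq> ell2_essential_spectrum (op_add h0 (mult_op V))"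
proof
  fix z assume z: "z \<in> ell2_spectrum (op_add h0 (mult_op V'))"
  let ?\<sigma> = "ell2_spectrum (op_add h0 (mult_op V))"
  define S where "S = jacobi (potential V z)"
  have S: "bounded_linear S"
    unfolding S_def by (rule bounded_linear_jacobi[OF bounded_potential[OF V(1)]])
  obtain r where r: "z = of_real r" using spectrum_real[OF V(2) z] by blast
  have sym: "S x \<bullet> y = x \<bullet> S y" for x y
    unfolding S_def r by (rule symmetric_jacobi[OF V(1)])
  have "\<not> bounded_below (jacobi (potential V' z))"
    using z by (simp add: spectrum_iff_not_bounded_below V)
  note approx = approximate_eigenvector_far_out[OF V this recur, folded S_def]
  have "z \<in> ?\<sigma>"
    unfolding spectrum_iff_not_bounded_below[OF V(1)]
  proof
    assume "bounded_below (jacobi (potential V z))"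
    then obtain c where c: "c > 0" "\<And>x. c * norm x \<le> norm (S x)" unfolding bounded_below_def S_def by blast
    obtain x where "norm x = 1" "norm (S x) \<le> c / 2" using approx[of "c / 2"] c(1) by fastforce
    with c(2)[of x] c(1) show False by simp
  qed
  moreover have "\<not> z isolated_in ?\<sigma>"
  proof
    assume "z isolated_in ?\<sigma>"
    then obtain \<delta> where \<delta>: "\<delta> > 0" "\<And>w. w \<in> ?\<sigma> \<Longrightarrow> w \<noteq> z \<Longrightarrow> \<delta> \<le> dist w z"
      unfolding isolated_in_islimpt_iff islimpt_approachable by (meson not_le)
    \<comment> \<open>Isolation of \<open>z\<close> supplies the punctured gap that
      \<open>symmetric_gap_at_zero\<close> requires.\<close>
    have "\<exists>c>0. \<forall>x. c * norm x \<le> norm (S x - \<mu> *\<^sub>R x)" if \<mu>: "\<mu> \<noteq> 0" "\<bar>\<mu>\<bar> < \<delta>" for \<mu> :: real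
    proof -
      have "z + of_real \<mu> \<notin> ?\<sigma>" using \<delta>(2)[of "z + of_real \<mu>"] \<mu> by (auto simp: dist_norm)
      moreover have "jacobi (potential V (z + of_real \<mu>)) x = S x - \<mu> *\<^sub>R x" for x
        unfolding S_def jacobi_potential_diff[OF V(1), of "z + of_real \<mu>" x z] by (rule l2_eqI) simp
      ultimately show ?thesis
        unfolding spectrum_iff_not_bounded_below[OF V(1)] bounded_below_def by simp
    qed
    note near = symmetric_gap_near_kernel[OF S sym \<delta>(1) symmetric_gap_at_zero[OF S sym \<delta>(1) this]]
    \<comment> \<open>An error of \<open>\<delta> / 4\<close> against a gap of
      \<open>\<delta>\<close> puts a kernel vector within 1/4 of each approximate
      eigenvector.\<close>
    have "\<delta> / 4 > 0" using \<delta> by simp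
    obtain u1 M1 where u1: "norm u1 = 1" "\<And>n. coord u1 n \<noteq> 0 \<Longrightarrow> \<bar>n\<bar> \<le> M1" "norm (S u1) \<le> \<delta> / 4"
      using approx[OF _ \<open>\<delta> / 4 > 0\<close>, of 0] by blast
    obtain u2 where u2: "norm u2 = 1" "\<And>n. coord u2 n \<noteq> 0 \<Longrightarrow> M1 < \<bar>n\<bar>" "norm (S u2) \<le> \<delta> / 4"
      using approx[OF _ \<open>\<delta> / 4 > 0\<close>, of M1] by blast
    obtain y1 where y1: "S y1 = 0" "\<delta> * norm (u1 - y1) \<le> norm (S u1)" using near by blast
    obtain y2 where y2: "S y2 = 0" "\<delta> * norm (u2 - y2) \<le> norm (S u2)" using near by blast
    have d1: "norm (u1 - y1) \<le> 1 / 4"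
    proof -
      have "\<delta> * norm (u1 - y1) \<le> \<delta> * (1 / 4)" using y1(2) u1(3) by simp
      then show ?thesis using \<delta>(1) by (simp only: mult_le_cancel_left_pos)
    qed
    have d2: "norm (u2 - y2) \<le> 1 / 4"
    proof -
      have "\<delta> * norm (u2 - y2) \<le> \<delta> * (1 / 4)" using y2(2) u2(3) by simp
      then show ?thesis using \<delta>(1) by (simp only: mult_le_cancel_left_pos)
    qed
    have "y2 \<noteq> 0" using d2 u2(1) by auto
    then obtain c where c: "y1 = cscale c y2"
      using jacobi_kernel_proportional[OF bounded_potential[OF V(1)]] y1(1) y2(1) unfolding S_def by blast
    \<comment> \<open>If \<open>y1\<close> is \<open>c\<close> times \<open>y2\<close>, then
      \<open>u1\<close> lies within \<open>(1 + cmod c) / 4\<close> of \<open>cscale c u2\<close>.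
      Disjoint supports make the squared distance \<open>1 + (cmod c)\<^sup>2\<close>, which is too
      large for that.\<close>
    have "u1 - cscale c u2 = (u1 - y1) - cscale c (u2 - y2)"
      by (rule l2_eqI) (simp add: c algebra_simps)
    then have "norm (u1 - cscale c u2) = norm ((u1 - y1) - cscale c (u2 - y2))" by (rule arg_cong)
    also have "\<dots> \<le> norm (u1 - y1) + norm (cscale c (u2 - y2))" by (rule norm_triangle_ineq4)
    also have "\<dots> \<le> 1 / 4 + cmod c * (1 / 4)"
      using d1 mult_left_mono[OF d2, of "cmod c"] by simp
    finally have "(norm (u1 - cscale c u2))\<^sup>2 \<le> (1 / 4 + cmod c * (1 / 4))\<^sup>2"
      by (rule power_mono) simp
    moreover have "(norm (u1 - cscale c u2))\<^sup>2 = 1 + (cmod c)\<^sup>2"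
    proof -
      have "u1 \<bullet> cscale c u2 = 0"
        unfolding inner_eq_infsum
      proof (rule infsum_0)
        fix n
        have "coord u1 n = 0 \<or> coord u2 n = 0" using u1(2)[of n] u2(2)[of n] by linarith
        then show "coord u1 n \<bullet> coord (cscale c u2) n = 0" by auto
      qed
      moreover have "(norm (u1 - cscale c u2))\<^sup>2 = (norm u1)\<^sup>2 - 2 * (u1 \<bullet> cscale c u2) + (norm (cscale c u2))\<^sup>2"
        unfolding power2_norm_eq_inner
        by (simp add: inner_diff_left inner_diff_right inner_commute[of "cscale c u2" u1])
      ultimately show ?thesis by (simp add: u1 u2)
    qed
    moreover have "(1 / 4 + cmod c * (1 / 4))\<^sup>2 < 1 + (cmod c)\<^sup>2"
    proof -
      have "2 * cmod c \<le> 1 + (cmod c)\<^sup>2" using sum_squares_bound[of 1 "cmod c"] by simp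
      then have "(1 + 2 * cmod c + (cmod c)\<^sup>2) / 16 < 1 + (cmod c)\<^sup>2"
        using zero_le_power2[of "cmod c"] by argo
      also have "(1 + 2 * cmod c + (cmod c)\<^sup>2) / 16 = (1 / 4 + cmod c * (1 / 4))\<^sup>2"
        by (simp add: power2_eq_square field_simps)
      finally show ?thesis .
    qed
    ultimately show False by simp
  qed
  ultimately show "z \<in> ell2_essential_spectrum (op_add h0 (mult_op V))"
    by (simp add: ell2_essential_spectrum_def ell2_discrete_spectrum_def)
qed

section \<open>Fredholm estimate\<close>

text \<open>Cutting off commutes with the hopping term except at the four sites next to the boundary.\<close>

lemma norm_jacobi_cutoff_le:
  assumes \<phi>: "bounded (range \<phi>)" and "a < b"
  shows "(norm (jacobi \<phi> (cutoff {a..b} x)))\<^sup>2 \<le> 2 * (\<Sum>n\<in>{a..b}. (cmod (coord (jacobi \<phi> x) n))\<^sup>2) +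
    2 * ((cmod (coord x a))\<^sup>2 + (cmod (coord x (a - 1)))\<^sup>2 + (cmod (coord x b))\<^sup>2 + (cmod (coord x (b + 1)))\<^sup>2)"
proof -
  define A where "A = cutoff {a..b} (jacobi \<phi> x)"
  \<comment> \<open>\<open>E\<close> is the commutator of hopping and cutoff applied to
    \<open>x\<close>; \<open>a < b\<close> makes its four sites distinct.\<close>
  define E where "E = jacobi \<phi> (cutoff {a..b} x) - A"
  have E: "coord E n = (if n = a - 1 then coord x a else if n = a then - coord x (a - 1)
      else if n = b then - coord x (b + 1) else if n = b + 1 then coord x b else 0)" for n
    using \<open>a < b\<close> by (auto simp: E_def A_def coord_cutoff coord_jacobi \<phi>)
  have "(norm E)\<^sup>2 = (\<Sum>n\<in>{a - 1, a, b, b + 1}. (cmod (coord E n))\<^sup>2)"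
    by (rule norm_finite_support) (auto simp: E)
  also have "\<dots> = (cmod (coord x a))\<^sup>2 + (cmod (coord x (a - 1)))\<^sup>2 + (cmod (coord x b))\<^sup>2 + (cmod (coord x (b + 1)))\<^sup>2"
    using \<open>a < b\<close> by (simp add: E)
  finally have "(norm E)\<^sup>2 = \<dots>" .
  moreover have "(norm A)\<^sup>2 = (\<Sum>n\<in>{a..b}. (cmod (coord (jacobi \<phi> x) n))\<^sup>2)"
    by (simp add: A_def norm_cutoff)
  moreover have "(norm (A + E))\<^sup>2 \<le> 2 * (norm A)\<^sup>2 + 2 * (norm E)\<^sup>2"
  proof -
    have "(norm (A + E))\<^sup>2 \<le> (norm A + norm E)\<^sup>2" by (intro power_mono norm_triangle_ineq) simp
    then show ?thesis using sum_squares_bound[of "norm A" "norm E"] by (simp add: power2_sum)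
  qed
  ultimately show ?thesis by (simp add: E_def)
qed

lemma has_sum_finite_sum:
  fixes f :: "'i \<Rightarrow> 'a \<Rightarrow> 'b::topological_comm_monoid_add"
  assumes "\<And>i. i \<in> I \<Longrightarrow> (f i has_sum s i) A"
  shows "((\<lambda>x. \<Sum>i\<in>I. f i x) has_sum (\<Sum>i\<in>I. s i)) A"
  using assms by (induction I rule: infinite_finite_induct) (auto intro: has_sum_add)

text \<open>The estimate is obtained by summing a local lower bound over all windows of a fixed length far
  away from the origin; the boundary terms do not grow with the length of the window.\<close>

lemma fredholm_estimate:
  assumes V: "bounded (range V)" "bounded (range V')"
    and below: "bounded_below (jacobi (potential V' z))"
    and close: "\<And>L \<epsilon>. \<epsilon> > 0 \<Longrightarrow> \<exists>N. \<forall>n. \<bar>n\<bar> > N \<longrightarrow> (\<exists>k. \<forall>m. \<bar>m\<bar> \<le> int L \<longrightarrow> \<bar>V (n + m) - V' (k + m)\<bar> \<le> \<epsilon>)"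
  shows "\<exists>C>0. \<exists>F G. finite F \<and> finite G \<and> (\<forall>x. (norm x)\<^sup>2 \<le> C * ((norm (jacobi (potential V z) x))\<^sup>2
    + (\<Sum>n\<in>F. \<Sum>m\<in>G. (cmod (coord x (n + m :: int)))\<^sup>2)))"
proof -
  define S where "S = jacobi (potential V z)"
  obtain c where c: "c > 0" "\<And>x. c * norm x \<le> norm (jacobi (potential V' z) x)"
    using below unfolding bounded_below_def by blast
  \<comment> \<open>Half of the lower bound \<open>c\<close> is spent on the mismatch of the
    potentials, which leaves \<open>c / 2\<close>.\<close>
  define \<kappa> where "\<kappa> = (c / 2)\<^sup>2"
  have \<kappa>: "\<kappa> > 0" using c(1) by (simp add: \<kappa>_def)
  \<comment> \<open>Summed over all centres, the windows count each site \<open>D\<close> times,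
    while the boundary terms contribute only \<open>8 * (norm x)\<^sup>2\<close>. The choice gives
    \<open>16 \<le> \<kappa> * D\<close>, so that these can be absorbed.\<close>
  obtain L0 :: nat where "16 / \<kappa> < real L0" using reals_Archimedean2 by blast
  \<comment> \<open>The successor makes \<open>L\<close> positive, so that a window has distinct
    endpoints as \<open>norm_jacobi_cutoff_le\<close> demands.\<close>
  define L where "L = Suc L0"
  define D where "D = 2 * real L + 1"
  have D: "16 \<le> \<kappa> * D" "D > 0" "D \<ge> 1"
    using \<open>16 / \<kappa> < real L0\<close> \<kappa> by (auto simp: L_def D_def field_simps)
  define G where "G = {- int L..int L}"
  have card_G: "real (card G) = D" by (simp add: G_def D_def)
  obtain N where N: "\<And>n. \<bar>n\<bar> > N \<Longrightarrow> \<exists>k. \<forall>m. \<bar>m\<bar> \<le> int L \<longrightarrow> \<bar>V (n + m) - V' (k + m)\<bar> \<le> c / 2"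
    using close[of "c / 2" L] c(1) by auto
  define F where "F = {- N..N}"
  have main: "(norm x)\<^sup>2 \<le> (4 / \<kappa> + 2) * ((norm (S x))\<^sup>2 + (\<Sum>n\<in>F. \<Sum>m\<in>G. (cmod (coord x (n + m)))\<^sup>2))" for x
  proof -
    define X where "X n = (cmod (coord x n))\<^sup>2" for n
    define Y where "Y n = (cmod (coord (S x) n))\<^sup>2" for n
    define Z where "Z = (\<Sum>n\<in>F. \<Sum>m\<in>G. X (n + m))"
    have X0: "X n \<ge> 0" "Y n \<ge> 0" for n by (simp_all add: X_def Y_def)
    have Z0: "Z \<ge> 0" unfolding Z_def by (intro sum_nonneg X0)
    have shift_sum: "(\<Sum>n\<in>{n - int L..n + int L}. f n) = (\<Sum>m\<in>G. f (n + m))" for f :: "int \<Rightarrow> real" and n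
      unfolding G_def by (rule sum.reindex_bij_witness[where i = "\<lambda>m. n + m" and j = "\<lambda>j. j - n"]) auto
    \<comment> \<open>Each boundary site is written as \<open>n\<close> plus a constant, so that
      \<open>sumX\<close> sums it over \<open>n\<close>.\<close>
    have local_bound: "\<kappa> * (\<Sum>m\<in>G. X (n + m)) \<le> 2 * (\<Sum>m\<in>G. Y (n + m)) +
        2 * (X (n + - int L) + X (n + (- int L - 1)) + X (n + int L) + X (n + (int L + 1)))"
      if n: "\<bar>n\<bar> > N" for n
    proof -
      define y where "y = cutoff {n - int L..n + int L} x"
      obtain k where k: "\<And>m. \<bar>m\<bar> \<le> int L \<Longrightarrow> \<bar>V (n + m) - V' (k + m)\<bar> \<le> c / 2" using N[OF n] by blast
      have "\<bar>norm (S y) - norm (jacobi (potential V' z) (shift (- (k - n)) y))\<bar> \<le> c / 2 * norm y"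
        unfolding S_def
      proof (rule jacobi_compare[OF V])
        fix j assume "coord y j \<noteq> 0"
        then have "\<bar>j - n\<bar> \<le> int L" by (auto simp: y_def coord_cutoff split: if_splits)
        from k[OF this] show "\<bar>V j - V' (j + (k - n))\<bar> \<le> c / 2" by (simp add: algebra_simps)
      qed (use c(1) in simp)
      moreover have "c * norm y \<le> norm (jacobi (potential V' z) (shift (- (k - n)) y))"
        using c(2)[of "shift (- (k - n)) y"] by simp
      ultimately have "c / 2 * norm y \<le> norm (S y)" by argo
      then have "(c / 2 * norm y)\<^sup>2 \<le> (norm (S y))\<^sup>2" by (rule power_mono) (use c(1) in simp)
      also have "(c / 2 * norm y)\<^sup>2 = \<kappa> * (norm y)\<^sup>2" by (simp only: \<kappa>_def power_mult_distrib)
      also have "(norm y)\<^sup>2 = (\<Sum>m\<in>G. X (n + m))"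
        by (simp add: y_def norm_cutoff X_def shift_sum)
      also have "(norm (S y))\<^sup>2 \<le> 2 * (\<Sum>m\<in>G. Y (n + m)) +
          2 * (X (n - int L) + X (n - int L - 1) + X (n + int L) + X (n + int L + 1))"
        using norm_jacobi_cutoff_le[OF bounded_potential[OF V(1)], of "n - int L" "n + int L" z x]
        unfolding y_def S_def[symmetric] X_def Y_def shift_sum by (simp add: L_def)
      finally show ?thesis by (simp add: algebra_simps)
    qed
    have sumX: "((\<lambda>n. X (n + m)) has_sum (norm x)\<^sup>2) UNIV" for m
      using norm_has_sum[of "shift m x"] by (simp add: X_def)
    have sumY: "((\<lambda>n. Y (n + m)) has_sum (norm (S x))\<^sup>2) UNIV" for m
      using norm_has_sum[of "shift m (S x)"] by (simp add: Y_def)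
    have sumGX: "((\<lambda>n. \<Sum>m\<in>G. X (n + m)) has_sum (\<Sum>m\<in>G. (norm x)\<^sup>2)) UNIV"
      by (rule has_sum_finite_sum) (rule sumX)
    have sumGY: "((\<lambda>n. \<Sum>m\<in>G. Y (n + m)) has_sum (\<Sum>m\<in>G. (norm (S x))\<^sup>2)) UNIV"
      by (rule has_sum_finite_sum) (rule sumY)
    have sumZ: "((\<lambda>n. if n \<in> F then \<Sum>m\<in>G. X (n + m) else 0) has_sum Z) UNIV"
      by (rule has_sum_finite_neutralI[of F]) (auto simp: F_def Z_def)
    \<comment> \<open>No local bound is available for centres in \<open>F\<close>; there the term
      \<open>\<kappa> * Z\<close> supplies the left side.\<close>
    have "\<kappa> * (\<Sum>m\<in>G. (norm x)\<^sup>2) \<le> (2 * (\<Sum>m\<in>G. (norm (S x))\<^sup>2) +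
        2 * ((norm x)\<^sup>2 + (norm x)\<^sup>2 + (norm x)\<^sup>2 + (norm x)\<^sup>2)) + \<kappa> * Z"
    proof (rule has_sum_mono)
      show "((\<lambda>n. \<kappa> * (\<Sum>m\<in>G. X (n + m))) has_sum \<kappa> * (\<Sum>m\<in>G. (norm x)\<^sup>2)) UNIV"
        by (rule has_sum_cmult_right[OF sumGX])
      show "((\<lambda>n. (2 * (\<Sum>m\<in>G. Y (n + m)) +
          2 * (X (n + - int L) + X (n + (- int L - 1)) + X (n + int L) + X (n + (int L + 1)))) +
          \<kappa> * (if n \<in> F then \<Sum>m\<in>G. X (n + m) else 0)) has_sum
          (2 * (\<Sum>m\<in>G. (norm (S x))\<^sup>2) +
        2 * ((norm x)\<^sup>2 + (norm x)\<^sup>2 + (norm x)\<^sup>2 + (norm x)\<^sup>2)) + \<kappa> * Z) UNIV"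
        by (intro has_sum_add has_sum_cmult_right sumGY sumX sumZ)
      fix n
      show "\<kappa> * (\<Sum>m\<in>G. X (n + m)) \<le> (2 * (\<Sum>m\<in>G. Y (n + m)) +
          2 * (X (n + - int L) + X (n + (- int L - 1)) + X (n + int L) + X (n + (int L + 1)))) +
          \<kappa> * (if n \<in> F then \<Sum>m\<in>G. X (n + m) else 0)"
      proof (cases "n \<in> F")
        case True
        have "0 \<le> 2 * (\<Sum>m\<in>G. Y (n + m)) +
          2 * (X (n + - int L) + X (n + (- int L - 1)) + X (n + int L) + X (n + (int L + 1)))"
          by (intro add_nonneg_nonneg mult_nonneg_nonneg sum_nonneg X0) auto
        with True show ?thesis by simp
      next
        case False
        then have "\<bar>n\<bar> > N" by (auto simp: F_def)
        from local_bound[OF this] False show ?thesis by simp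
      qed
    qed
    then have "\<kappa> * D * (norm x)\<^sup>2 \<le> 2 * D * (norm (S x))\<^sup>2 + 8 * (norm x)\<^sup>2 + \<kappa> * Z"
      by (simp add: card_G algebra_simps)
    \<comment> \<open>The boundary contribution is at most half of the left side and is absorbed
      there.\<close>
    moreover have "16 * (norm x)\<^sup>2 \<le> \<kappa> * D * (norm x)\<^sup>2" by (rule mult_right_mono[OF D(1)]) simp
    moreover have "\<kappa> * Z \<le> \<kappa> * D * Z"
      using mult_right_mono[OF D(3), of "\<kappa> * Z"] \<kappa> Z0 by (simp add: algebra_simps)
    ultimately have "\<kappa> * D * (norm x)\<^sup>2 \<le> 4 * D * (norm (S x))\<^sup>2 + 2 * (\<kappa> * D * Z)" by argo
    also have "\<dots> = \<kappa> * D * (4 / \<kappa> * (norm (S x))\<^sup>2 + 2 * Z)" using \<kappa> by (simp add: field_simps)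
    finally have "(norm x)\<^sup>2 \<le> 4 / \<kappa> * (norm (S x))\<^sup>2 + 2 * Z"
      using \<kappa> D(2) by (simp add: mult_le_cancel_left_pos)
    also have "\<dots> \<le> (4 / \<kappa> + 2) * (norm (S x))\<^sup>2 + (4 / \<kappa> + 2) * Z"
      using \<kappa> Z0 by (intro add_mono mult_right_mono) auto
    finally show ?thesis by (simp add: Z_def X_def distrib_left)
  qed
  have "4 / \<kappa> + 2 > 0" "finite F" "finite G" using \<kappa> by (auto simp: F_def G_def intro: add_pos_pos)
  with main show ?thesis unfolding S_def by blast
qed

text \<open>A diagonal subsequence converges in every coordinate. The estimate, applied to
  differences, upgrades this to convergence in norm, since besides \<open>S\<close> it involves only
  finitely many coordinates.\<close>

lemma fredholm_compactness:
  fixes S :: "l2 \<Rightarrow> l2"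
  assumes S: "bounded_linear S" and C: "C > 0" "finite F" "finite G"
    and est: "\<And>x. (norm x)\<^sup>2 \<le> C * ((norm (S x))\<^sup>2 + (\<Sum>n\<in>F. \<Sum>m\<in>G. (cmod (coord x (n + m)))\<^sup>2))"
    and X: "\<And>j::nat. norm (X j) = 1" "(\<lambda>j. S (X j)) \<longlonglongrightarrow> 0"
  shows "\<exists>r x. strict_mono r \<and> (X \<circ> r) \<longlonglongrightarrow> x \<and> norm x = 1 \<and> S x = 0"
proof -
  interpret S: bounded_linear S by (rule S)
  obtain r where r: "strict_mono r" and conv: "\<And>n. \<exists>l. (\<lambda>j. coord (X (r j)) n) \<longlonglongrightarrow> l"
  proof (rule function_convergent_subsequence[of "UNIV :: int set" "\<lambda>j. coord (X j)" 1])
    show "cmod (coord (X j) n) \<le> 1" for j n using coord_le_norm[of "X j" n] X(1) by simp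
  qed auto
  obtain l where l: "\<And>n. (\<lambda>j. coord (X (r j)) n) \<longlonglongrightarrow> l n" using conv by metis
  \<comment> \<open>Comparing with the coordinatewise limits splits the estimate for a pair of
    indices into one null sequence for each index.\<close>
  define \<rho> where "\<rho> j = (norm (S (X (r j))))\<^sup>2 + (\<Sum>n\<in>F. \<Sum>m\<in>G. (cmod (coord (X (r j)) (n + m) - l (n + m)))\<^sup>2)" for j
  have S0: "(\<lambda>j. S (X (r j))) \<longlonglongrightarrow> 0" using LIMSEQ_subseq_LIMSEQ[OF X(2) r] by (simp add: o_def)
  have "\<rho> \<longlonglongrightarrow> (norm (0::l2))\<^sup>2 + (\<Sum>n\<in>F. \<Sum>m\<in>G. (cmod (l (n + m) - l (n + m)))\<^sup>2)"
    unfolding \<rho>_def by (intro tendsto_intros l S0)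
  then have \<rho>: "\<rho> \<longlonglongrightarrow> 0" by simp
  have par: "(norm (a - b))\<^sup>2 \<le> 2 * (norm a)\<^sup>2 + 2 * (norm b)\<^sup>2" for a b :: "'a::real_normed_vector"
  proof -
    have "(norm (a - b))\<^sup>2 \<le> (norm a + norm b)\<^sup>2" by (intro power_mono norm_triangle_ineq4) simp
    then show ?thesis using sum_squares_bound[of "norm a" "norm b"] by (simp add: power2_sum)
  qed
  have diff: "(norm (X (r i) - X (r j)))\<^sup>2 \<le> C * (2 * \<rho> i + 2 * \<rho> j)" for i j
  proof -
    have "(\<Sum>n\<in>F. \<Sum>m\<in>G. (cmod (coord (X (r i) - X (r j)) (n + m)))\<^sup>2) \<le>
      (\<Sum>n\<in>F. \<Sum>m\<in>G. 2 * (cmod (coord (X (r i)) (n + m) - l (n + m)))\<^sup>2 + 2 * (cmod (coord (X (r j)) (n + m) - l (n + m)))\<^sup>2)"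
    proof (intro sum_mono)
      fix n m
      show "(cmod (coord (X (r i) - X (r j)) (n + m)))\<^sup>2 \<le>
        2 * (cmod (coord (X (r i)) (n + m) - l (n + m)))\<^sup>2 + 2 * (cmod (coord (X (r j)) (n + m) - l (n + m)))\<^sup>2"
        using par[of "coord (X (r i)) (n + m) - l (n + m)" "coord (X (r j)) (n + m) - l (n + m)"] by simp
    qed
    moreover have "(norm (S (X (r i) - X (r j))))\<^sup>2 \<le> 2 * (norm (S (X (r i))))\<^sup>2 + 2 * (norm (S (X (r j))))\<^sup>2"
      unfolding S.diff by (rule par)
    ultimately have "(norm (S (X (r i) - X (r j))))\<^sup>2 + (\<Sum>n\<in>F. \<Sum>m\<in>G. (cmod (coord (X (r i) - X (r j)) (n + m)))\<^sup>2)
      \<le> 2 * \<rho> i + 2 * \<rho> j"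
      by (simp add: \<rho>_def sum.distrib sum_distrib_left)
    then show ?thesis using est[of "X (r i) - X (r j)"] C(1) by (meson mult_left_mono less_imp_le order_trans)
  qed
  have "Cauchy (X \<circ> r)"
  proof (rule CauchyI)
    fix e :: real assume "e > 0"
    have "e\<^sup>2 / (4 * C) > 0" using \<open>e > 0\<close> C(1) by simp
    from order_tendstoD(2)[OF \<rho> this]
    obtain N where N: "\<And>j. j \<ge> N \<Longrightarrow> \<rho> j < e\<^sup>2 / (4 * C)" by (auto simp: eventually_sequentially)
    have "norm (X (r i) - X (r j)) < e" if "i \<ge> N" "j \<ge> N" for i j
    proof -
      have "C * (2 * \<rho> i + 2 * \<rho> j) < C * (2 * (e\<^sup>2 / (4 * C)) + 2 * (e\<^sup>2 / (4 * C)))"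
        using N[OF that(1)] N[OF that(2)] C(1) by (intro mult_strict_left_mono) auto
      also have "\<dots> = e\<^sup>2" using C(1) by simp
      finally have "(norm (X (r i) - X (r j)))\<^sup>2 < e\<^sup>2" using diff[of i j] by simp
      then show ?thesis by (rule power_less_imp_less_base) (use \<open>e > 0\<close> in simp)
    qed
    then show "\<exists>M. \<forall>i\<ge>M. \<forall>j\<ge>M. norm ((X \<circ> r) i - (X \<circ> r) j) < e" by auto
  qed
  then obtain x where x: "(X \<circ> r) \<longlonglongrightarrow> x" by (auto simp: Cauchy_convergent_iff convergent_def)
  have "norm x = 1"
    using LIMSEQ_unique[OF tendsto_norm[OF x], of 1] X(1) by simp
  moreover have "S x = 0"
    using LIMSEQ_unique[OF S.tendsto[OF x], of 0] S0 by (simp add: o_def)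
  ultimately show ?thesis using r x by blast
qed

text \<open>Outside the spectrum for \<open>V'\<close>, compactness turns approximate eigenvectors
  for \<open>V\<close> into eigenvectors. If such a point \<open>z\<close> of the spectrum were a
  limit of others, their unit eigenvectors would accumulate at an eigenvector for \<open>z\<close>
  to which all of them are orthogonal.\<close>

lemma essential_spectrum_subset_spectrum:
  assumes V: "bounded (range V)" "bounded (range V')"
    and close: "\<And>L \<epsilon>. \<epsilon> > 0 \<Longrightarrow> \<exists>N. \<forall>n. \<bar>n\<bar> > N \<longrightarrow> (\<exists>k. \<forall>m. \<bar>m\<bar> \<le> int L \<longrightarrow> \<bar>V (n + m) - V' (k + m)\<bar> \<le> \<epsilon>)"
  shows "ell2_essential_spectrum (op_add h0 (mult_op V)) \<subseteq> ell2_spectrum (op_add h0 (mult_op V'))"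
proof (rule ccontr)
  let ?H = "op_add h0 (mult_op V)"
  assume "\<not> ell2_essential_spectrum ?H \<subseteq> ell2_spectrum (op_add h0 (mult_op V'))"
  then obtain z where z: "z \<in> ell2_spectrum ?H" "z \<notin> ell2_discrete_spectrum ?H"
      "bounded_below (jacobi (potential V' z))"
    by (auto simp: ell2_essential_spectrum_def spectrum_iff_not_bounded_below V)
  define S where "S w = jacobi (potential V w)" for w
  have S: "bounded_linear (S w)" for w
    unfolding S_def by (rule bounded_linear_jacobi[OF bounded_potential[OF V(1)]])
  have compact: "\<exists>r x. strict_mono r \<and> (X \<circ> r) \<longlonglongrightarrow> x \<and> norm x = 1 \<and> S w x = 0"
    if w: "bounded_below (jacobi (potential V' w))"
      and X: "\<And>j::nat. norm (X j) = 1" "(\<lambda>j. S w (X j)) \<longlonglongrightarrow> 0" for w X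
  proof -
    obtain C F G where "C > 0" "finite F" "finite G" and
      "\<And>x. (norm x)\<^sup>2 \<le> C * ((norm (S w x))\<^sup>2 + (\<Sum>n\<in>F. \<Sum>m\<in>G. (cmod (coord x (n + m)))\<^sup>2))"
      using fredholm_estimate[OF V w close] unfolding S_def by auto
    from fredholm_compactness[OF S this X] show ?thesis .
  qed
  have eigenvector: "\<exists>x. norm x = 1 \<and> S w x = 0"
    if w: "w \<in> ell2_spectrum ?H" "bounded_below (jacobi (potential V' w))" for w
  proof -
    have "\<not> bounded_below (S w)" using w(1) by (simp add: S_def spectrum_iff_not_bounded_below V)
    then obtain X where "\<And>j::nat. norm (X j) = 1" "(\<lambda>j. S w (X j)) \<longlonglongrightarrow> 0"
      using bounded_below_tendsto_zero[OF _ bounded_linear.linear[OF S]] by blast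
    from compact[OF w(2) this] show ?thesis by blast
  qed
  have "\<not> z islimpt ell2_spectrum ?H"
  proof
    assume lim: "z islimpt ell2_spectrum ?H"
    obtain c where c: "c > 0" "\<And>x. c * norm x \<le> norm (jacobi (potential V' z) x)"
      using z(3) unfolding bounded_below_def by blast
    have "\<exists>w x. w \<in> ell2_spectrum ?H \<and> w \<noteq> z \<and> norm (w - z) \<le> inverse (real (Suc j)) \<and> norm x = 1 \<and> S w x = 0" for j
    proof -
      \<comment> \<open>Distance below \<open>c / 2\<close> preserves half of the lower bound for
        \<open>V'\<close>, so \<open>w\<close> too is an eigenvalue for \<open>V\<close>.\<close>
      have "min (c / 2) (inverse (real (Suc j))) > 0" using c(1) by simp
      then obtain w where w: "w \<in> ell2_spectrum ?H" "w \<noteq> z" "dist w z < min (c / 2) (inverse (real (Suc j)))"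
        using lim unfolding islimpt_approachable by blast
      have "c / 2 * norm x \<le> norm (jacobi (potential V' w) x)" for x
      proof -
        have "norm (jacobi (potential V' z) x) \<le> norm (jacobi (potential V' w) x) + norm (cscale (w - z) x)"
          using norm_triangle_ineq[of "jacobi (potential V' w) x" "cscale (w - z) x"]
          by (simp add: jacobi_potential_diff[OF V(2), of w x z])
        moreover have "cmod (w - z) * norm x \<le> c / 2 * norm x"
          using w(3) by (intro mult_right_mono) (auto simp: dist_norm)
        ultimately show ?thesis using c(2)[of x] by simp
      qed
      then have "bounded_below (jacobi (potential V' w))"
        unfolding bounded_below_def using c(1) by (intro exI[of _ "c / 2"]) auto
      from eigenvector[OF w(1) this] w show ?thesis by (fastforce simp: dist_norm)
    qed
    then obtain w X where w: "\<And>j. w j \<in> ell2_spectrum ?H" "\<And>j. w j \<noteq> z" "\<And>j. norm (w j - z) \<le> inverse (real (Suc j))"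
      and X: "\<And>j::nat. norm (X j) = 1" "\<And>j. S (w j) (X j) = 0" by metis
    have SX: "S z (X j) = cscale (w j - z) (X j)" for j
      using X(2)[of j] jacobi_potential_diff[OF V(1), of "w j" "X j" z] by (simp add: S_def)
    have "(\<lambda>j. S z (X j)) \<longlonglongrightarrow> 0"
      by (rule Lim_null_comparison[OF _ LIMSEQ_inverse_real_of_nat])
         (intro always_eventually allI, simp only: SX norm_cscale X(1) mult_1_right w(3))
    from compact[OF z(3) X(1) this] obtain r x
      where r: "strict_mono r" "(X \<circ> r) \<longlonglongrightarrow> x" "norm x = 1" "S z x = 0" by blast
    \<comment> \<open>Both eigenvalues are real and they differ, so symmetry makes the eigenvectors
      orthogonal.\<close>
    have "X j \<bullet> x = 0" for j
    proof -
      define t where "t = Re (w j) - Re z"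
      have eq: "w j - z = of_real t"
        using spectrum_real[OF V(1) w(1)[of j]] spectrum_real[OF V(1) z(1)] by (simp add: t_def complex_eq_iff)
      have "t * (X j \<bullet> x) = S z (X j) \<bullet> x"
      proof -
        have "cscale (of_real t) (X j) = t *\<^sub>R X j" by (rule l2_eqI) simp
        then show ?thesis by (simp add: SX eq)
      qed
      also have "\<dots> = X j \<bullet> S z x"
        unfolding S_def using symmetric_jacobi[OF V(1), of "Re z"] spectrum_real[OF V(1) z(1)] by simp
      also have "\<dots> = 0" by (simp add: r)
      finally show ?thesis using w(2)[of j] eq by auto
    qed
    then have "(\<lambda>j. (X \<circ> r) j \<bullet> x) \<longlonglongrightarrow> 0" by simp
    \<comment> \<open>As a limit of vectors orthogonal to it, \<open>x\<close> is orthogonal to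
      itself.\<close>
    then have "x \<bullet> x = 0" using LIMSEQ_unique[OF tendsto_inner[OF r(2) tendsto_const]] by blast
    then show False using r(3) by simp
  qed
  moreover have "\<exists>u\<in>ell2_eigenspace ?H z. u \<noteq> (\<lambda>n. 0)"
  proof -
    obtain x where x: "norm x = 1" "S z x = 0" using eigenvector[OF z(1,3)] by blast
    have "op_shift ?H z (coord x) = (\<lambda>n. 0)"
      using coord_jacobi_potential[OF V(1), of z x] x(2) by (simp add: S_def fun_eq_iff)
    then have "?H (coord x) = (\<lambda>n. z * coord x n)" by (simp add: op_shift_def fun_eq_iff)
    moreover have "coord x \<noteq> (\<lambda>n. 0)"
    proof
      assume "coord x = (\<lambda>n. 0)"
      then have "x = 0" by (intro l2_eqI) simp
      then show False using x(1) by simp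
    qed
    ultimately show ?thesis by (intro bexI[of _ "coord x"]) (simp_all add: ell2_eigenspace_def coord)
  qed
  ultimately have "z \<in> ell2_discrete_spectrum ?H"
    using z(1) eigenspace_finite_dimensional[OF V(1)]
    by (simp add: ell2_discrete_spectrum_def isolated_in_islimpt_iff)
  then show False using z(2) by simp
qed

section \<open>Almost periodicity\<close>

lemma zero_in_integer_lattice: "0 \<in> integer_lattice"
  by (simp add: integer_lattice_def)

lemma integer_lattice_add: "a \<in> integer_lattice \<Longrightarrow> b \<in> integer_lattice \<Longrightarrow> a + b \<in> integer_lattice"
  by (simp add: integer_lattice_def)

lemma integer_lattice_diff: "a \<in> integer_lattice \<Longrightarrow> b \<in> integer_lattice \<Longrightarrow> a - b \<in> integer_lattice"
  by (simp add: integer_lattice_def)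

lemma torus_class_eq_iff: "torus_class x = torus_class y \<longleftrightarrow> x - y \<in> integer_lattice"
proof
  assume "torus_class x = torus_class y"
  moreover have "x \<in> torus_class x"
    using zero_in_integer_lattice by (fastforce simp: torus_class_def)
  ultimately show "x - y \<in> integer_lattice" by (auto simp: torus_class_def)
next
  have sub: "torus_class x \<subseteq> torus_class y" if "x - y \<in> integer_lattice" for x y :: "real^'a"
  proof
    fix v assume "v \<in> torus_class x"
    then obtain a where "v = x + a" "a \<in> integer_lattice" by (auto simp: torus_class_def)
    then have "v = y + (x - y + a)" "x - y + a \<in> integer_lattice"
      using integer_lattice_add[OF that] by auto
    then show "v \<in> torus_class y" unfolding torus_class_def by blast
  qed
  assume "x - y \<in> integer_lattice"
  moreover from this have "y - x \<in> integer_lattice"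
    using integer_lattice_diff[OF zero_in_integer_lattice] by fastforce
  ultimately show "torus_class x = torus_class y" using sub by blast
qed

text \<open>The projection to the torus maps a ball to an open set, because the preimage of that
  image is the union of the lattice translates of the ball. Density puts an orbit point
  there.\<close>

lemma torus_dense_imp_approx:
  fixes p :: "int \<Rightarrow> real^'d"
  assumes dense: "torus_topology closure_of range (\<lambda>n. torus_class (p n)) = topspace torus_topology"
    and "\<theta> > 0"
  shows "\<exists>k. \<exists>a\<in>integer_lattice. norm (p k + a - x) < \<theta>"
proof -
  define U where "U = torus_class ` ball x \<theta>"
  have "torus_class -` U = (\<Union>a\<in>integer_lattice. (+) a ` ball x \<theta>)"
  proof (intro equalityI subsetI)
    fix v assume "v \<in> torus_class -` U"
    then obtain u where "u \<in> ball x \<theta>" "v - u \<in> integer_lattice"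
      by (auto simp: U_def torus_class_eq_iff)
    then show "v \<in> (\<Union>a\<in>integer_lattice. (+) a ` ball x \<theta>)"
      by (intro UN_I[of "v - u"] image_eqI[of _ _ u]) auto
  next
    fix v assume "v \<in> (\<Union>a\<in>integer_lattice. (+) a ` ball x \<theta>)"
    then obtain a u where "a \<in> integer_lattice" "u \<in> ball x \<theta>" "v = a + u" by blast
    then show "v \<in> torus_class -` U"
      unfolding U_def vimage_eq by (intro image_eqI[of _ _ u]) (simp_all add: torus_class_eq_iff)
  qed
  then have "open (torus_class -` U)" by (simp add: open_UN open_translation)
  then have "openin torus_topology U" by (auto simp: openin_torus_topology U_def)
  moreover have "torus_class x \<in> U" using \<open>\<theta> > 0\<close> by (simp add: U_def)
  moreover have "torus_class x \<in> torus_topology closure_of range (\<lambda>n. torus_class (p n))"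
    by (simp add: dense topspace_torus_topology)
  ultimately obtain k where "torus_class (p k) \<in> U" unfolding in_closure_of by blast
  then obtain u where u: "u \<in> ball x \<theta>" "u - p k \<in> integer_lattice"
    unfolding U_def by (metis imageE torus_class_eq_iff)
  have "norm (p k + (u - p k) - x) < \<theta>" using u(1) by (simp add: dist_norm norm_minus_commute)
  with u(2) show ?thesis by blast
qed

text \<open>Subtracting integer parts moves \<open>x\<close> into the unit cube, where the sum of
  the coordinates bounds the norm.\<close>

lemma translate_into_ball:
  fixes x :: "real^'d"
  shows "\<exists>a\<in>integer_lattice. norm (x + a) \<le> real CARD('d)"
proof
  show "(\<chi> i. - of_int \<lfloor>x $ i\<rfloor>) \<in> integer_lattice" by (simp add: integer_lattice_def)
  have "norm (x + (\<chi> i. - of_int \<lfloor>x $ i\<rfloor>)) \<le> (\<Sum>i\<in>UNIV. \<bar>(x + (\<chi> i. - of_int \<lfloor>x $ i\<rfloor>)) $ i\<bar>)"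
    by (rule norm_le_l1_cart)
  also have "\<dots> \<le> (\<Sum>i\<in>(UNIV :: 'd set). 1)"
    by (intro sum_mono) (simp add: abs_le_iff, linarith)
  finally show "norm (x + (\<chi> i. - of_int \<lfloor>x $ i\<rfloor>)) \<le> real CARD('d)" by simp
qed

text \<open>The bound on \<open>k\<close> must not depend on \<open>x\<close>, since
  \<open>f\<close> is nearly constant only over windows of fixed length. Lattice translations reduce
  to a compact ball, which finitely many of the open sets \<open>U k\<close> cover.\<close>

lemma torus_dense_imp_uniform_approx:
  fixes p :: "int \<Rightarrow> real^'d"
  assumes dense: "torus_topology closure_of range (\<lambda>n. torus_class (p n)) = topspace torus_topology"
    and "\<theta> > 0"
  shows "\<exists>M::nat. \<forall>x. \<exists>k. \<bar>k\<bar> \<le> int M \<and> (\<exists>a\<in>integer_lattice. norm (p k + a - x) < \<theta>)"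
proof -
  define U where "U k = (\<Union>a\<in>integer_lattice. ball (p k + a) \<theta>)" for k
  let ?K = "cball (0 :: real^'d) (real CARD('d))"
  have cover: "?K \<subseteq> (\<Union>k\<in>UNIV. U k)"
  proof
    fix x assume "x \<in> ?K"
    from torus_dense_imp_approx[OF assms, of x] show "x \<in> (\<Union>k\<in>UNIV. U k)"
      by (auto simp: U_def dist_norm)
  qed
  have "open (U k)" for k by (auto simp: U_def)
  with cover obtain C where C: "finite C" "?K \<subseteq> (\<Union>k\<in>C. U k)"
    using compactE_image[OF compact_cball, of UNIV U 0 "real CARD('d)"] by (metis (no_types, lifting))
  define M where "M = nat (Max (abs ` C))"
  have M: "\<bar>k\<bar> \<le> int M" if "k \<in> C" for k
  proof -
    have "\<bar>k\<bar> \<le> Max (abs ` C)" using C(1) that by (intro Max_ge) auto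
    then show ?thesis unfolding M_def by linarith
  qed
  show ?thesis
  proof (intro exI[of _ M] allI)
    fix x :: "real^'d"
    obtain b where b: "b \<in> integer_lattice" "norm (x + b) \<le> real CARD('d)" using translate_into_ball by blast
    then have "x + b \<in> (\<Union>k\<in>C. U k)" using C(2) by auto
    then obtain k a where ka: "k \<in> C" "a \<in> integer_lattice" "norm (p k + a - (x + b)) < \<theta>"
      by (auto simp: U_def dist_norm)
    then have "norm (p k + (a - b) - x) < \<theta>" by (simp add: algebra_simps)
    with M[OF ka(1)] integer_lattice_diff[OF ka(2) b(1)]
    show "\<exists>k. \<bar>k\<bar> \<le> int M \<and> (\<exists>a\<in>integer_lattice. norm (p k + a - x) < \<theta>)" by blast
  qed
qed

text \<open>A common lattice translation moves both points into a compact ball. The extra 1 in its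
  radius leaves room for \<open>y\<close>, whose distance from \<open>x\<close> is taken below
  1.\<close>

lemma periodic_uniformly_continuous:
  fixes W :: "real^'d \<Rightarrow> real"
  assumes cont: "continuous_on UNIV W" and periodic: "\<And>x a. a \<in> integer_lattice \<Longrightarrow> W (x + a) = W x"
    and "\<epsilon> > 0"
  shows "\<exists>\<theta>>0. \<forall>x y. norm (x - y) < \<theta> \<longrightarrow> \<bar>W x - W y\<bar> < \<epsilon>"
proof -
  let ?K = "cball (0 :: real^'d) (real CARD('d) + 1)"
  have "uniformly_continuous_on ?K W"
    by (rule compact_uniformly_continuous[OF continuous_on_subset[OF cont]]) auto
  then obtain \<theta> where \<theta>: "\<theta> > 0" "\<And>x y. x \<in> ?K \<Longrightarrow> y \<in> ?K \<Longrightarrow> dist y x < \<theta> \<Longrightarrow> dist (W y) (W x) < \<epsilon>"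
    using \<open>\<epsilon> > 0\<close> unfolding uniformly_continuous_on_def by metis
  have "\<bar>W x - W y\<bar> < \<epsilon>" if xy: "norm (x - y) < min \<theta> 1" for x y
  proof -
    obtain a where a: "a \<in> integer_lattice" "norm (x + a) \<le> real CARD('d)" using translate_into_ball by blast
    have "norm (y + a) \<le> norm (x + a) + norm (x - y)"
      using norm_triangle_ineq4[of "x + a" "x - y"] by (simp add: add.commute)
    then have "x + a \<in> ?K" "y + a \<in> ?K" using a(2) xy unfolding mem_cball_0 by linarith+
    then have "dist (W (x + a)) (W (y + a)) < \<epsilon>"
      using xy by (intro \<theta>(2)) (auto simp: dist_norm)
    then show ?thesis by (simp add: periodic[OF a(1)] dist_real_def)
  qed
  then show ?thesis using \<theta>(1) by (intro exI[of _ "min \<theta> 1"]) auto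
qed

text \<open>The filter expresses that the absolute value of \<open>n\<close> tends to infinity. The
  supremum is over a finite set, so it bounds each of its terms.\<close>

lemma slowly_varying_uniform:
  fixes f :: "int \<Rightarrow> 'a::real_normed_vector"
  assumes "((\<lambda>n. SUP m\<in>{- int L..int L}. norm (f n - f (n + m))) \<longlongrightarrow> 0) (filtercomap (\<lambda>n::int. \<bar>n\<bar>) at_top)"
    and "\<theta> > 0"
  shows "\<exists>N. \<forall>n. \<bar>n\<bar> \<ge> N \<longrightarrow> (\<forall>m. \<bar>m\<bar> \<le> int L \<longrightarrow> norm (f n - f (n + m)) < \<theta>)"
proof -
  obtain N where N: "\<And>n. \<bar>n\<bar> \<ge> N \<Longrightarrow> (SUP m\<in>{- int L..int L}. norm (f n - f (n + m))) < \<theta>"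
    using order_tendstoD(2)[OF assms] unfolding eventually_filtercomap_at_top_linorder by blast
  have "norm (f n - f (n + m)) < \<theta>" if "\<bar>n\<bar> \<ge> N" "\<bar>m\<bar> \<le> int L" for n m
  proof -
    have "norm (f n - f (n + m)) \<le> (SUP m\<in>{- int L..int L}. norm (f n - f (n + m)))"
      by (rule cSUP_upper) (use that(2) in auto)
    then show ?thesis using N[OF that(1)] by simp
  qed
  then show ?thesis by blast
qed

theorem theorem5p2:
  fixes W :: "real^'d \<Rightarrow> real"
    and \<alpha> :: "real^'d"
    and f :: "int \<Rightarrow> real^'d"
    and V\<^sub>0 V :: "int \<Rightarrow> real"
  assumes W_bounded: "bounded (range W)"
    and W_continuous: "continuous_on UNIV W"
    and W_periodic: "\<And>x a. a \<in> integer_lattice \<Longrightarrow> W (x + a) = W x"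
    and dense: "torus_topology closure_of range (\<lambda>n::int. torus_class (of_int n *\<^sub>R \<alpha>))
                  = topspace torus_topology"
    and slowly_varying:
      "\<And>L::nat. ((\<lambda>n. SUP m\<in>{- int L..int L}. norm (f n - f (n + m))) \<longlongrightarrow> 0)
                   (filtercomap (\<lambda>n::int. \<bar>n\<bar>) at_top)"
    and V\<^sub>0_def: "\<And>n. V\<^sub>0 n = W (of_int n *\<^sub>R \<alpha>)"
    and V_def: "\<And>n. V n = W (of_int n *\<^sub>R \<alpha> + f n)"
  shows "ell2_essential_spectrum (op_add h0 (mult_op V)) = ell2_spectrum (op_add h0 (mult_op V\<^sub>0))"
proof
  have V: "bounded (range V)" and V\<^sub>0: "bounded (range V\<^sub>0)"
    by (rule bounded_subset[OF W_bounded], force simp: V_def V\<^sub>0_def)+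
  note periodic_cont = periodic_uniformly_continuous[OF W_continuous W_periodic]
  show "ell2_essential_spectrum (op_add h0 (mult_op V)) \<subseteq> ell2_spectrum (op_add h0 (mult_op V\<^sub>0))"
  proof (rule essential_spectrum_subset_spectrum[OF V V\<^sub>0])
    fix L :: nat and \<epsilon> :: real assume "\<epsilon> > 0"
    then obtain \<theta> where \<theta>: "\<theta> > 0" "\<And>x y. norm (x - y) < \<theta> \<Longrightarrow> \<bar>W x - W y\<bar> < \<epsilon> / 2"
      using periodic_cont[of "\<epsilon> / 2"] by auto
    obtain N where N: "\<And>n m. \<bar>n\<bar> \<ge> N \<Longrightarrow> \<bar>m\<bar> \<le> int L \<Longrightarrow> norm (f n - f (n + m)) < \<theta>"
      using slowly_varying_uniform[OF slowly_varying \<theta>(1)] by blast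
    have "\<exists>k. \<forall>m. \<bar>m\<bar> \<le> int L \<longrightarrow> \<bar>V (n + m) - V\<^sub>0 (k + m)\<bar> \<le> \<epsilon>" if n: "\<bar>n\<bar> > N" for n
    proof -
      \<comment> \<open>Density matches the phase at \<open>n\<close> with an orbit point modulo the
        lattice. Adding m times \<open>\<alpha>\<close> to both keeps the match throughout the
        window.\<close>
      obtain k a where a: "a \<in> integer_lattice"
        and k: "norm (of_int k *\<^sub>R \<alpha> + a - (of_int n *\<^sub>R \<alpha> + f n)) < \<theta>"
        using torus_dense_imp_approx[OF dense \<theta>(1)] by blast
      have "\<bar>V (n + m) - V\<^sub>0 (k + m)\<bar> \<le> \<epsilon>" if m: "\<bar>m\<bar> \<le> int L" for m
      proof -
        \<comment> \<open>Freezing \<open>f\<close> at the centre separates the error of slow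
          variation from that of the phase match.\<close>
        define v where "v = of_int (n + m) *\<^sub>R \<alpha> + f n"
        have "\<bar>W (of_int (n + m) *\<^sub>R \<alpha> + f (n + m)) - W v\<bar> < \<epsilon> / 2"
          by (rule \<theta>(2)) (use N[of n m] n m in \<open>simp add: v_def norm_minus_commute\<close>)
        moreover have "\<bar>W (of_int (k + m) *\<^sub>R \<alpha> + a) - W v\<bar> < \<epsilon> / 2"
          by (rule \<theta>(2)) (use k in \<open>simp add: v_def algebra_simps\<close>)
        ultimately show ?thesis by (simp only: V_def V\<^sub>0_def W_periodic[OF a])
      qed
      then show ?thesis by blast
    qed
    then show "\<exists>N. \<forall>n. \<bar>n\<bar> > N \<longrightarrow> (\<exists>k. \<forall>m. \<bar>m\<bar> \<le> int L \<longrightarrow> \<bar>V (n + m) - V\<^sub>0 (k + m)\<bar> \<le> \<epsilon>)" by blast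
  qed
  show "ell2_spectrum (op_add h0 (mult_op V\<^sub>0)) \<subseteq> ell2_essential_spectrum (op_add h0 (mult_op V))"
  proof (rule spectrum_subset_essential_spectrum[OF V V\<^sub>0])
    fix L :: nat and N :: int and \<epsilon> :: real assume "\<epsilon> > 0"
    then obtain \<theta> where \<theta>: "\<theta> > 0" "\<And>x y. norm (x - y) < \<theta> \<Longrightarrow> \<bar>W x - W y\<bar> < \<epsilon> / 2"
      using periodic_cont[of "\<epsilon> / 2"] by auto
    obtain M :: nat where M: "\<And>x. \<exists>k. \<bar>k\<bar> \<le> int M \<and> (\<exists>a\<in>integer_lattice. norm (of_int k *\<^sub>R \<alpha> + a - x) < \<theta>)"
      using torus_dense_imp_uniform_approx[OF dense \<theta>(1)] by blast
    \<comment> \<open>The window will be centred at \<open>j + k\<close> while \<open>f\<close> is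
      frozen at \<open>j\<close>, hence the radius \<open>M + L\<close>.\<close>
    obtain N' where N': "\<And>n m. \<bar>n\<bar> \<ge> N' \<Longrightarrow> \<bar>m\<bar> \<le> int (M + L) \<Longrightarrow> norm (f n - f (n + m)) < \<theta>"
      using slowly_varying_uniform[OF slowly_varying \<theta>(1)] by blast
    \<comment> \<open>The size of \<open>j\<close> keeps \<open>j\<close> beyond \<open>N'\<close>
      and \<open>j + k\<close> beyond \<open>N\<close> for every \<open>k\<close> bounded by
      \<open>M\<close>.\<close>
    define j where "j = \<bar>N\<bar> + \<bar>N'\<bar> + int M + 1"
    \<comment> \<open>This \<open>k\<close> brings the phase at \<open>j\<close> back near the
      origin of the torus. It depends on \<open>f j\<close>, but its bound \<open>M\<close> was
      fixed before \<open>j\<close>, which avoids circularity.\<close>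
    obtain k a where k: "\<bar>k\<bar> \<le> int M" and a: "a \<in> integer_lattice"
      and ka: "norm (of_int k *\<^sub>R \<alpha> + a - (- (of_int j *\<^sub>R \<alpha> + f j))) < \<theta>"
      using M by blast
    show "\<exists>n. \<bar>n\<bar> > N \<and> (\<forall>m. \<bar>m\<bar> \<le> int L \<longrightarrow> \<bar>V (n + m) - V\<^sub>0 m\<bar> \<le> \<epsilon>)"
    proof (intro exI[of _ "j + k"] conjI allI impI)
      show "\<bar>j + k\<bar> > N" using k by (simp add: j_def)
      fix m assume m: "\<bar>m\<bar> \<le> int L"
      define v where "v = of_int (j + k + m) *\<^sub>R \<alpha> + f j"
      have "norm (f j - f (j + (k + m))) < \<theta>" by (rule N') (use k m in \<open>simp_all add: j_def\<close>)
      then have "\<bar>W (of_int (j + k + m) *\<^sub>R \<alpha> + f (j + k + m)) - W v\<bar> < \<epsilon> / 2"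
        by (intro \<theta>(2)) (simp add: v_def norm_minus_commute add.assoc)
      moreover have "\<bar>W (v + a) - W (of_int m *\<^sub>R \<alpha>)\<bar> < \<epsilon> / 2"
        by (rule \<theta>(2)) (use ka in \<open>simp add: v_def algebra_simps\<close>)
      ultimately show "\<bar>V (j + k + m) - V\<^sub>0 m\<bar> \<le> \<epsilon>" by (simp only: V_def V\<^sub>0_def W_periodic[OF a])
    qed
  qed
qed

end
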